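(* Let $\mathcal L$ be an operator as in the context, with distinct eigenvalues $0<\mu_1<\mu_2<\cdots$ (listed without multiplicity), $\mu_n$ having multiplicity $d_n\le D<\infty$, where $D$ is the maximal multiplicity, and suppose: (A1) there are $M>0$, $\sigma\in(0,1]$ and $\beta>1$ with $\mu_n=Mn^{\beta}(1+o(n^{-\sigma}))$ as $n\to\infty$; (A2) there are $\theta>0$ and $s\ge 0$ with $\mu_{n+1}-\mu_n\ge\theta n^{-s}$ for all $n\ge1$. For $j=1,\dots,D$ suppose that $g_j$ has the eigenfunction expansion $$g_j(x)=\sum_{n=1}^\infty\sum_{l=1}^{d_n}b^n_{j,l}\,\phi_{n,l}(x).$$ Let $B_n=(b^n_{j,l})_{j,l}\in\mathbb R^{D\times d_n}$, denote by $B_n^\dagger$ the Moore–Penrose inverse of $B_n$, and assume $\|B_n^\dagger\|\le Le^{pn^{\alpha}}$ for all $n\ge1$, with constants $L>0$, $p\ge0$ and $\alpha\in[0,\beta)$. Let $f\in L^2(\Omega)$ and let $u_j(x,t)$ and $w(x,t)$ be the solutions of the evolution equation with initial conditions $g_j$ and $f$ respectively. Then for all $0\le t_0<t_1<\infty$ and all $\tau>t_0$ there exist functions $\nu_j(\cdot\,;\tau)\in L^2[t_0,t_1]$, $j=1,\dots,D$, such that $$w(x,\tau)=\sum_{j=1}^D\int_{t_0}^{t_1}u_j(x,t)\,\nu_j(t;\tau)\,dt.$$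
   Context: Setting. $\Omega\subset\mathbb R^d$ is a compact domain with smooth boundary (if not empty). $\mathcal L=\sum_{0\le|\gamma|\le N_{\mathcal L}}p_\gamma(x)\partial^\gamma$ ($\gamma$ a multi-index) is a self-adjoint strongly elliptic differential operator of order $N_{\mathcal L}$ with coefficients $p_\gamma\in C^{|\gamma|+N_{\mathcal L}/2}(\overline\Omega)$ and Dirichlet boundary condition $\partial^\gamma u=0$ on $\partial\Omega$ for $|\gamma|\le\frac{N_{\mathcal L}}2-1$. Its eigenvalues are positive. For each $n$, $\phi_{n,1},\dots,\phi_{n,d_n}$ are eigenfunctions for $\mu_n$, and the family $\{\phi_{n,l}\}$ is a complete orthonormal basis of $L^2(\Omega)$. The evolution equation is $\partial_tu=-\mathcal Lu$ with the homogeneous Dirichlet boundary condition $\partial^\gamma u(x,t)=0$ for $x\in\partial\Omega$ and $|\gamma|\le\frac{N_{\mathcal L}}2-1$; its solution with initial condition given by the expansion $\sum_n\sum_l a_{n,l}\phi_{n,l}$ is $\sum_n e^{-\mu_nt}\sum_l a_{n,l}\phi_{n,l}(x)$.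
   Formalization: It is additionally assumed that each B_n has full column rank d_n; a bound on the norm of the Moore–Penrose inverse alone does not ensure this (B_n = 0 gives all g_j = 0, and the claim fails for f = φ_{1,1}). *)

theory Defs
  imports
    "HOL-Analysis.Analysis"
    "HOL-Library.Landau_Symbols"
    "Jordan_Normal_Form.DL_Rank"
begin

subsection \<open>Multi-indices and partial derivatives\<close>

definition mi_order :: "('d::finite \<Rightarrow> nat) \<Rightarrow> nat"
  where "mi_order \<gamma> = (\<Sum>i\<in>UNIV. \<gamma> i)"

definition partial :: "'d::finite \<Rightarrow> (real^'d \<Rightarrow> real) \<Rightarrow> real^'d \<Rightarrow> real"
  where "partial i f x = frechet_derivative f (at x) (axis i 1)"

primrec partials :: "'d::finite list \<Rightarrow> (real^'d \<Rightarrow> real) \<Rightarrow> real^'d \<Rightarrow> real"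
  where
    "partials [] f = f"
  | "partials (i # is) f = partial i (partials is f)"

text \<open>The index type carries no order, so the sequence in which the \<open>mi_order \<gamma>\<close> differentiations
  are carried out is chosen arbitrarily. It is only used for functions of class
  \<open>C\<^sup>k\<close> with \<open>mi_order \<gamma> \<le> k\<close>, where partial derivatives commute.\<close>

definition mpartial :: "('d::finite \<Rightarrow> nat) \<Rightarrow> (real^'d \<Rightarrow> real) \<Rightarrow> real^'d \<Rightarrow> real"
  where "mpartial \<gamma> f = partials (SOME is. \<forall>i. count_list is i = \<gamma> i) f"

text \<open>\<open>C\<^sup>k(S)\<close> for open \<open>S\<close>.\<close>

primrec Ck_on :: "nat \<Rightarrow> (real^'d::finite) set \<Rightarrow> (real^'d \<Rightarrow> real) \<Rightarrow> bool"
  where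
    "Ck_on 0 S f \<longleftrightarrow> continuous_on S f"
  | "Ck_on (Suc k) S f \<longleftrightarrow> f differentiable_on S \<and> (\<forall>i. Ck_on k S (partial i f))"

text \<open>For a compact \<open>\<Omega>\<close> which is the closure of its interior, \<open>C\<^sup>k(\<Omega>)\<close> consists
  of the \<open>C\<^sup>k\<close> functions on the interior whose derivatives of order at most \<open>k\<close> extend
  continuously to \<open>\<Omega>\<close>. Functions are total; their values outside \<open>\<Omega>\<close> are irrelevant.\<close>

definition Ck_closed :: "nat \<Rightarrow> (real^'d::finite) set \<Rightarrow> (real^'d \<Rightarrow> real) \<Rightarrow> bool"
  where "Ck_closed k \<Omega> f \<longleftrightarrow>
    Ck_on k (interior \<Omega>) f \<and> continuous_on \<Omega> f \<and>
    (\<forall>\<gamma>. mi_order \<gamma> \<le> k \<longrightarrow>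
      (\<exists>v. continuous_on \<Omega> v \<and> (\<forall>x\<in>interior \<Omega>. v x = mpartial \<gamma> f x)))"

text \<open>The derivative as a function on all of \<open>\<Omega>\<close>: at boundary points it is the continuous
  extension from the interior, at interior points the limit is the derivative itself.\<close>

definition deriv_ext :: "(real^'d::finite) set \<Rightarrow> ('d \<Rightarrow> nat) \<Rightarrow> (real^'d \<Rightarrow> real) \<Rightarrow> real^'d \<Rightarrow> real"
  where "deriv_ext \<Omega> \<gamma> f x = Lim (at x within interior \<Omega>) (mpartial \<gamma> f)"


subsection \<open>Domains\<close>

text \<open>Near each boundary point, \<open>\<Omega>\<close> is a sublevel set of a smooth function with
  non-vanishing gradient.\<close>

definition smooth_boundary :: "(real^'d::finite) set \<Rightarrow> bool"
  where "smooth_boundary \<Omega> \<longleftrightarrow>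
    (\<forall>x\<in>frontier \<Omega>. \<exists>U \<rho>. open U \<and> x \<in> U \<and> (\<forall>k. Ck_on k U \<rho>) \<and>
      (\<forall>y\<in>U. \<exists>i. partial i \<rho> y \<noteq> 0) \<and> \<Omega> \<inter> U = {y\<in>U. \<rho> y \<le> 0})"

definition smooth_compact_domain :: "(real^'d::finite) set \<Rightarrow> bool"
  where "smooth_compact_domain \<Omega> \<longleftrightarrow>
    compact \<Omega> \<and> \<Omega> \<noteq> {} \<and> connected (interior \<Omega>) \<and> closure (interior \<Omega>) = \<Omega> \<and>
    smooth_boundary \<Omega>"


subsection \<open>Square-integrable functions\<close>

definition L2 :: "'a::euclidean_space set \<Rightarrow> ('a \<Rightarrow> real) set"
  where "L2 S = {f. f \<in> borel_measurable (lebesgue_on S) \<and>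
    integrable (lebesgue_on S) (\<lambda>x. (f x)\<^sup>2)}"

definition L2_inner :: "'a::euclidean_space set \<Rightarrow> ('a \<Rightarrow> real) \<Rightarrow> ('a \<Rightarrow> real) \<Rightarrow> real"
  where "L2_inner S f g = integral\<^sup>L (lebesgue_on S) (\<lambda>x. f x * g x)"

definition L2_norm :: "'a::euclidean_space set \<Rightarrow> ('a \<Rightarrow> real) \<Rightarrow> real"
  where "L2_norm S f = sqrt (L2_inner S f f)"

definition L2_orthonormal_basis ::
    "'a::euclidean_space set \<Rightarrow> 'i set \<Rightarrow> ('i \<Rightarrow> 'a \<Rightarrow> real) \<Rightarrow> bool"
  where "L2_orthonormal_basis S I e \<longleftrightarrow>
    (\<forall>i\<in>I. e i \<in> L2 S) \<and>
    (\<forall>i\<in>I. \<forall>k\<in>I. L2_inner S (e i) (e k) = (if i = k then 1 else 0)) \<and>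
    (\<forall>h\<in>L2 S. (\<forall>i\<in>I. L2_inner S h (e i) = 0) \<longrightarrow> (AE x in lebesgue_on S. h x = 0))"


subsection \<open>The differential operator\<close>

text \<open>The operator is given by its order \<open>N\<close> and its coefficients \<open>p \<gamma>\<close>.\<close>

definition diff_op ::
    "(real^'d::finite) set \<Rightarrow> nat \<Rightarrow> (('d \<Rightarrow> nat) \<Rightarrow> real^'d \<Rightarrow> real) \<Rightarrow>
      (real^'d \<Rightarrow> real) \<Rightarrow> real^'d \<Rightarrow> real"
  where "diff_op \<Omega> N p u x = (\<Sum>\<gamma> | mi_order \<gamma> \<le> N. p \<gamma> x * deriv_ext \<Omega> \<gamma> u x)"

text \<open>The bound \<open>mi_order \<gamma> < N div 2\<close> is \<open>|\<gamma>| \<le> N/2 - 1\<close> without truncated subtraction.\<close>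

definition dirichlet_domain :: "(real^'d::finite) set \<Rightarrow> nat \<Rightarrow> (real^'d \<Rightarrow> real) set"
  where "dirichlet_domain \<Omega> N = {u. Ck_closed N \<Omega> u \<and>
    (\<forall>x\<in>frontier \<Omega>. \<forall>\<gamma>. mi_order \<gamma> < N div 2 \<longrightarrow> deriv_ext \<Omega> \<gamma> u x = 0)}"

text \<open>With the sign below, the principal part of \<open>-\<Delta>\<close> is strongly elliptic.\<close>

definition strongly_elliptic ::
    "(real^'d::finite) set \<Rightarrow> nat \<Rightarrow> (('d \<Rightarrow> nat) \<Rightarrow> real^'d \<Rightarrow> real) \<Rightarrow> bool"
  where "strongly_elliptic \<Omega> N p \<longleftrightarrow> even N \<and>
    (\<exists>c>0. \<forall>x\<in>\<Omega>. \<forall>\<xi>.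
      (-1) ^ (N div 2) * (\<Sum>\<gamma> | mi_order \<gamma> = N. p \<gamma> x * (\<Prod>i\<in>UNIV. vec_nth \<xi> i ^ \<gamma> i))
        \<ge> c * norm \<xi> ^ N)"

text \<open>Self-adjointness of the realization in \<open>L\<^sup>2(\<Omega>)\<close>, i.e. of the closure of the
  operator defined on the classical functions satisfying the Dirichlet condition. On the left,
  \<open>(v, h)\<close> belongs to the graph of the adjoint, on the right, to the graph of the closure.\<close>

definition self_adjoint_op ::
    "(real^'d::finite) set \<Rightarrow> nat \<Rightarrow> (('d \<Rightarrow> nat) \<Rightarrow> real^'d \<Rightarrow> real) \<Rightarrow> bool"
  where "self_adjoint_op \<Omega> N p \<longleftrightarrow>
    (\<forall>v\<in>L2 \<Omega>. \<forall>h\<in>L2 \<Omega>.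
      (\<forall>u\<in>dirichlet_domain \<Omega> N. L2_inner \<Omega> (diff_op \<Omega> N p u) v = L2_inner \<Omega> u h) \<longleftrightarrow>
      (\<exists>u. (\<forall>k::nat. u k \<in> dirichlet_domain \<Omega> N) \<and>
        (\<lambda>k. L2_norm \<Omega> (\<lambda>x. u k x - v x)) \<longlonglongrightarrow> 0 \<and>
        (\<lambda>k. L2_norm \<Omega> (\<lambda>x. diff_op \<Omega> N p (u k) x - h x)) \<longlonglongrightarrow> 0))"

definition elliptic_dirichlet_operator ::
    "(real^'d::finite) set \<Rightarrow> nat \<Rightarrow> (('d \<Rightarrow> nat) \<Rightarrow> real^'d \<Rightarrow> real) \<Rightarrow> bool"
  where "elliptic_dirichlet_operator \<Omega> N p \<longleftrightarrow>
    (\<forall>\<gamma>. mi_order \<gamma> \<le> N \<longrightarrow> Ck_closed (mi_order \<gamma> + N div 2) \<Omega> (p \<gamma>)) \<and>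
    strongly_elliptic \<Omega> N p \<and> self_adjoint_op \<Omega> N p"

definition eigenfunction ::
    "(real^'d::finite) set \<Rightarrow> nat \<Rightarrow> (('d \<Rightarrow> nat) \<Rightarrow> real^'d \<Rightarrow> real) \<Rightarrow> real \<Rightarrow>
      (real^'d \<Rightarrow> real) \<Rightarrow> bool"
  where "eigenfunction \<Omega> N p lam u \<longleftrightarrow>
    u \<in> dirichlet_domain \<Omega> N \<and> (\<exists>x\<in>\<Omega>. u x \<noteq> 0) \<and> (\<forall>x\<in>\<Omega>. diff_op \<Omega> N p u x = lam * u x)"

definition eigenvalues ::
    "(real^'d::finite) set \<Rightarrow> nat \<Rightarrow> (('d \<Rightarrow> nat) \<Rightarrow> real^'d \<Rightarrow> real) \<Rightarrow> real set"
  where "eigenvalues \<Omega> N p = {lam. \<exists>u. eigenfunction \<Omega> N p lam u}"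

text \<open>The eigenspace, regarded as a space of functions on \<open>\<Omega>\<close>, has a basis of \<open>m\<close> elements.\<close>

definition has_multiplicity ::
    "(real^'d::finite) set \<Rightarrow> nat \<Rightarrow> (('d \<Rightarrow> nat) \<Rightarrow> real^'d \<Rightarrow> real) \<Rightarrow> real \<Rightarrow> nat \<Rightarrow> bool"
  where "has_multiplicity \<Omega> N p lam m \<longleftrightarrow>
    (\<exists>e. (\<forall>l<m. eigenfunction \<Omega> N p lam (e l)) \<and>
      (\<forall>c. (\<forall>x\<in>\<Omega>. (\<Sum>l<m. c l * e l x) = 0) \<longrightarrow> (\<forall>l<m. c l = 0)) \<and>
      (\<forall>u. eigenfunction \<Omega> N p lam u \<longrightarrow> (\<exists>c. \<forall>x\<in>\<Omega>. u x = (\<Sum>l<m. c l * e l x))))"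

text \<open>Classical solutions of \<open>\<partial>\<^sub>t u = -\<L> u\<close> for \<open>t > 0\<close> with the Dirichlet condition; the
  initial value, an element of \<open>L\<^sup>2(\<Omega>)\<close>, is attained in \<open>L\<^sup>2(\<Omega>)\<close>. The values \<open>u x 0\<close> are
  not constrained.\<close>

definition evolution_solution ::
    "(real^'d::finite) set \<Rightarrow> nat \<Rightarrow> (('d \<Rightarrow> nat) \<Rightarrow> real^'d \<Rightarrow> real) \<Rightarrow>
      (real^'d \<Rightarrow> real) \<Rightarrow> (real^'d \<Rightarrow> real \<Rightarrow> real) \<Rightarrow> bool"
  where "evolution_solution \<Omega> N p g u \<longleftrightarrow>
    (\<forall>t>0. (\<lambda>x. u x t) \<in> dirichlet_domain \<Omega> N) \<and>
    continuous_on (\<Omega> \<times> {0<..}) (\<lambda>(x, t). u x t) \<and>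
    continuous_on (\<Omega> \<times> {0<..}) (\<lambda>(x, t). diff_op \<Omega> N p (\<lambda>y. u y t) x) \<and>
    (\<forall>x\<in>\<Omega>. \<forall>t>0. ((\<lambda>s. u x s) has_real_derivative - diff_op \<Omega> N p (\<lambda>y. u y t) x) (at t)) \<and>
    ((\<lambda>t. L2_norm \<Omega> (\<lambda>x. u x t - g x)) \<longlongrightarrow> 0) (at_right 0)"


subsection \<open>Matrices\<close>

text \<open>The four Penrose conditions, which determine \<open>X\<close> uniquely.\<close>

definition moore_penrose_inverse :: "real mat \<Rightarrow> real mat \<Rightarrow> bool"
  where "moore_penrose_inverse A X \<longleftrightarrow>
    X \<in> carrier_mat (dim_col A) (dim_row A) \<and>
    A * X * A = A \<and> X * A * X = X \<and>
    transpose_mat (A * X) = A * X \<and> transpose_mat (X * A) = X * A"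

text \<open>The operator norm with respect to the Euclidean norms.\<close>

definition op_norm :: "real mat \<Rightarrow> real"
  where "op_norm A =
    (SUP v\<in>{v \<in> carrier_vec (dim_col A). scalar_prod v v \<le> 1}.
      sqrt (scalar_prod (A *\<^sub>v v) (A *\<^sub>v v)))"

end

(*
  Testing both sides against the eigenfunctions, the claim becomes a moment problem: sum over j of
  b^n_{j,l} times the moment of nu_j against exp(-mu_n t) must equal exp(-mu_n tau) <f, phi_{n,l}>.
  As B_n^dagger B_n = 1, it is solved by nu_j = sum_n psi_n exp(-mu_n tau) (f_n B_n^dagger)_j for a
  family psi_n biorthogonal to the exponentials exp(-mu_n t). The series converges once
  |psi_n| <= K_eps exp(eps mu_n) for every eps > 0, up to a translation in time.

  Such psi_n are obtained with no functional analysis. With S_a f(t) = f(t - a), the operator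
  S_{a_k} - exp(-mu_k a_k) multiplies the Laplace transform at z by exp(-z a_k) - exp(-mu_k a_k),
  which vanishes at z = mu_k. Apply these operators for all k other than n to a tent function of
  small support. With a_k = c k^(-gamma) and 1 < gamma < beta, both sum a_k and sum exp(-mu_k a_k)
  converge, so the limit exists, is bounded uniformly in n and has small support. Its Laplace
  transform at mu_n is at least exp(-eps mu_n), up to a constant, by the gap condition.
*)
theory Submission
  imports Defs "HOL-Real_Asymp.Real_Asymp"
begin

text \<open>The condition \<beta> > 1 makes the reciprocals of the eigenvalues summable; this
  Muentz-type condition is what lets exponentials be separated on arbitrarily short intervals. Short
  support has a price, the growth \<open>exp (eps * mu_n)\<close>, and the smoothing of the
  evolution pays it: if the controls start at a time x0 strictly between t0 and \<tau>, a factor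
  \<open>exp (- mu_n * (tau - x0))\<close> is left over. It absorbs that growth together with the
  bound on B_n^dagger, since mu_n is of order n^\<beta> and \<alpha> < \<beta>. Leaving out one
  frequency must not spoil uniformity in n. Hence the upper bounds use the sums over all k, and only
  the value of the transform at mu_n is estimated for each n. The Moore-Penrose inverse is a left
  inverse precisely for full column rank: B_n = 0 has inverse 0, which satisfies every bound, and
  yet reaches nothing at the frequency mu_n. Testing against eigenfunctions yields equality almost
  everywhere. Equality at every point comes from continuity in x of the time averages, so the
  controls stay away from time 0, where the initial value is attained only in the mean.\<close>

subsection \<open>Products of shift operators\<close>

text \<open>The factor \<open>k\<close> is the identity if \<open>a k = 0\<close> and \<open>w k = 0\<close>; this is how a factor is left out
  below.\<close>

primrec shift_filter :: "(nat \<Rightarrow> real) \<Rightarrow> (nat \<Rightarrow> real) \<Rightarrow> (real \<Rightarrow> real) \<Rightarrow> nat \<Rightarrow> real \<Rightarrow> real"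
  where
    "shift_filter a w h 0 = h"
  | "shift_filter a w h (Suc k) =
      (\<lambda>t. shift_filter a w h k (t - a k) - w k * shift_filter a w h k t)"

lemma prod_one_plus_le_exp_suminf:
  fixes w :: "nat \<Rightarrow> real"
  assumes "\<And>i. w i \<ge> 0" "summable w"
  shows "(\<Prod>i<k. 1 + w i) \<le> exp (suminf w)"
proof -
  have "(\<Prod>i<k. 1 + w i) \<le> (\<Prod>i<k. exp (w i))"
    using assms(1) by (intro prod_mono) (auto intro: add_nonneg_nonneg)
  also have "\<dots> = exp (\<Sum>i<k. w i)"
    by (simp add: exp_sum)
  also have "\<dots> \<le> exp (suminf w)"
    using assms by (simp add: sum_le_suminf)
  finally show ?thesis .
qed

lemma lborel_integral_laplace_shift:
  fixes F :: "real \<Rightarrow> real"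
  shows "(LINT t|lborel. exp (- z * t) * F (t - a)) = exp (- z * a) * (LINT t|lborel. exp (- z * t) * F t)"
proof -
  have "(LINT t|lborel. exp (- z * t) * F (t - a)) = (LINT t|lborel. exp (- z * (a + t)) * F t)"
    by (subst lborel_integral_real_affine[of 1 _ a]) simp_all
  also have "\<dots> = (LINT t|lborel. exp (- z * a) * (exp (- z * t) * F t))"
    by (intro Bochner_Integration.integral_cong) (simp_all add: algebra_simps flip: exp_add)
  finally show ?thesis by simp
qed

lemma integrable_lborel_compact_support:
  fixes F G :: "real \<Rightarrow> real"
  assumes "continuous_on UNIV F" "continuous_on UNIV G" "\<And>t. t \<notin> {x..y} \<Longrightarrow> F t = 0"
  shows "integrable lborel (\<lambda>t. G t * F t)"
proof -
  have "integrable lborel (\<lambda>t. indicator {x..y} t *\<^sub>R (G t * F t))"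
    by (intro borel_integrable_compact continuous_intros continuous_on_subset[OF assms(1)]
        continuous_on_subset[OF assms(2)]) auto
  moreover have "(\<lambda>t. indicator {x..y} t *\<^sub>R (G t * F t)) = (\<lambda>t. G t * F t)"
    using assms(3) by (auto simp: indicator_def fun_eq_iff)
  ultimately show ?thesis by simp
qed

lemma lipschitz_continuous_on:
  fixes f :: "real \<Rightarrow> real"
  assumes "\<And>t t'. \<bar>f t - f t'\<bar> \<le> c * \<bar>t - t'\<bar>"
  shows "continuous_on UNIV f"
proof -
  have "c \<ge> 0" using assms[of 1 0] by simp
  then have "c-lipschitz_on UNIV f"
    using assms by (intro lipschitz_onI) (auto simp: dist_real_def)
  then show ?thesis by (rule lipschitz_on_continuous_on)
qed

context
  fixes a w :: "nat \<Rightarrow> real" and h :: "real \<Rightarrow> real" and H Lc e :: real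
  assumes a_nonneg: "\<And>i. a i \<ge> 0" and w_nonneg: "\<And>i. w i \<ge> 0"
    and a_summable: "summable a" and w_summable: "summable w"
    and h_bound: "\<And>t. \<bar>h t\<bar> \<le> H"
    and h_lipschitz: "\<And>t t'. \<bar>h t - h t'\<bar> \<le> Lc * \<bar>t - t'\<bar>"
    and h_support: "\<And>t. t \<notin> {0..e} \<Longrightarrow> h t = 0"
begin

text \<open>A shift changes neither the supremum nor the Lipschitz constant, so the factor
  \<open>k\<close> enlarges both by at most \<open>1 + w k\<close>, however large \<open>a k\<close>
  is. Summability of \<open>w\<close> then makes the bounds uniform in the number of
  factors.\<close>

lemma shift_filter_bound_prod: "\<bar>shift_filter a w h k t\<bar> \<le> H * (\<Prod>i<k. 1 + w i)"
proof (induction k arbitrary: t)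
  case 0
  then show ?case using h_bound by simp
next
  case (Suc k)
  have "\<bar>shift_filter a w h (Suc k) t\<bar> \<le>
      \<bar>shift_filter a w h k (t - a k)\<bar> + w k * \<bar>shift_filter a w h k t\<bar>"
    using w_nonneg[of k] abs_triangle_ineq4[of "shift_filter a w h k (t - a k)" "w k * shift_filter a w h k t"]
    by (simp add: abs_mult)
  also have "\<dots> \<le> H * (\<Prod>i<k. 1 + w i) + w k * (H * (\<Prod>i<k. 1 + w i))"
    using Suc w_nonneg[of k] by (intro add_mono mult_left_mono) auto
  finally show ?case by (simp add: algebra_simps)
qed

lemma shift_filter_lipschitz_prod:
  "\<bar>shift_filter a w h k t - shift_filter a w h k t'\<bar> \<le> Lc * (\<Prod>i<k. 1 + w i) * \<bar>t - t'\<bar>"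
proof (induction k arbitrary: t t')
  case 0
  then show ?case using h_lipschitz by simp
next
  case (Suc k)
  let ?f = "shift_filter a w h k"
  have "\<bar>shift_filter a w h (Suc k) t - shift_filter a w h (Suc k) t'\<bar> =
      \<bar>(?f (t - a k) - ?f (t' - a k)) - w k * (?f t - ?f t')\<bar>"
    by (simp add: algebra_simps)
  also have "\<dots> \<le> \<bar>?f (t - a k) - ?f (t' - a k)\<bar> + w k * \<bar>?f t - ?f t'\<bar>"
    using w_nonneg[of k] abs_triangle_ineq4[of "?f (t - a k) - ?f (t' - a k)" "w k * (?f t - ?f t')"]
    by (simp add: abs_mult)
  also have "\<dots> \<le> Lc * (\<Prod>i<k. 1 + w i) * \<bar>t - t'\<bar> + w k * (Lc * (\<Prod>i<k. 1 + w i) * \<bar>t - t'\<bar>)"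
    using Suc[of "t - a k" "t' - a k"] Suc[of t t'] w_nonneg[of k]
    by (intro add_mono mult_left_mono) auto
  finally show ?case by (simp add: algebra_simps)
qed

lemma filter_bounds_nonneg: "H \<ge> 0" "Lc \<ge> 0"
  using order_trans[OF abs_ge_zero h_bound[of 0]] order_trans[OF abs_ge_zero h_lipschitz[of 1 0]]
  by simp_all

lemma shift_filter_bound: "\<bar>shift_filter a w h k t\<bar> \<le> H * exp (suminf w)"
  by (rule order_trans[OF shift_filter_bound_prod])
    (intro mult_left_mono prod_one_plus_le_exp_suminf w_nonneg w_summable filter_bounds_nonneg)

lemma shift_filter_lipschitz:
  "\<bar>shift_filter a w h k t - shift_filter a w h k t'\<bar> \<le> Lc * exp (suminf w) * \<bar>t - t'\<bar>"
  by (rule order_trans[OF shift_filter_lipschitz_prod])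
    (intro mult_left_mono mult_right_mono prod_one_plus_le_exp_suminf w_nonneg w_summable filter_bounds_nonneg; simp)

text \<open>All shifts go to the right: the left end of the support stays at 0, and the right end
  moves by at most the sum of all \<open>a k\<close>.\<close>

lemma shift_filter_support: "t \<notin> {0..e + suminf a} \<Longrightarrow> shift_filter a w h k t = 0"
proof -
  have "t \<notin> {0..e + (\<Sum>i<k. a i)} \<Longrightarrow> shift_filter a w h k t = 0" for t
  proof (induction k arbitrary: t)
    case 0
    then show ?case using h_support by simp
  next
    case (Suc k)
    then show ?case using a_nonneg[of k] by (force simp: add.assoc)
  qed
  moreover assume "t \<notin> {0..e + suminf a}"
  ultimately show ?thesis
    using sum_le_suminf[OF a_summable, of "{..<k}"] a_nonneg by force
qed

lemma shift_filter_continuous: "continuous_on UNIV (shift_filter a w h k)"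
  by (rule lipschitz_continuous_on[OF shift_filter_lipschitz])

lemma shift_filter_laplace:
  "(LINT t|lborel. exp (- z * t) * shift_filter a w h k t) =
    (\<Prod>i<k. exp (- z * a i) - w i) * (LINT t|lborel. exp (- z * t) * h t)"
proof (induction k)
  case (Suc k)
  let ?f = "shift_filter a w h k"
  have i1: "integrable lborel (\<lambda>t. exp (- z * t) * ?f (t - a k))"
  proof (rule integrable_lborel_compact_support[where x="a k" and y="e + suminf a + a k"])
    show "continuous_on UNIV (\<lambda>t. ?f (t - a k))"
      by (intro continuous_on_compose2[OF shift_filter_continuous]) (auto intro!: continuous_intros)
    show "?f (t - a k) = 0" if "t \<notin> {a k..e + suminf a + a k}" for t
      using that by (intro shift_filter_support) auto
  qed (auto intro!: continuous_intros)
  have i2: "integrable lborel (\<lambda>t. exp (- z * t) * ?f t)"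
    by (rule integrable_lborel_compact_support[OF shift_filter_continuous _ shift_filter_support])
      (auto intro!: continuous_intros)
  have "(LINT t|lborel. exp (- z * t) * shift_filter a w h (Suc k) t) =
      (LINT t|lborel. exp (- z * t) * ?f (t - a k) - w k * (exp (- z * t) * ?f t))"
    by (simp add: algebra_simps)
  also have "\<dots> = (LINT t|lborel. exp (- z * t) * ?f (t - a k)) - w k * (LINT t|lborel. exp (- z * t) * ?f t)"
    using i1 i2 by (subst Bochner_Integration.integral_diff) auto
  finally show ?case
    unfolding lborel_integral_laplace_shift Suc by (simp add: algebra_simps)
qed simp

text \<open>One more factor changes the function by \<open>f (t - a k) - f t - w k * f t\<close>,
  which is at most a Lipschitz constant times \<open>a k\<close> plus a supremum times
  \<open>w k\<close>. Both constants are uniform in \<open>k\<close>, so the increments are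
  summable; this is why \<open>h\<close> has to be Lipschitz. The transforms converge by domination
  on the common compact support.\<close>

lemma shift_filter_limit:
  obtains G where "continuous_on UNIV G" "\<And>t. \<bar>G t\<bar> \<le> H * exp (suminf w)"
    "\<And>t. t \<notin> {0..e + suminf a} \<Longrightarrow> G t = 0"
    "\<And>z. (\<lambda>k. (\<Prod>i<k. exp (- z * a i) - w i) * (LINT t|lborel. exp (- z * t) * h t))
      \<longlonglongrightarrow> (LINT t|lborel. exp (- z * t) * G t)"
proof -
  let ?E = "exp (suminf w)"
  let ?f = "shift_filter a w h"
  have "convergent (\<lambda>k. ?f k t)" for t
  proof -
    have "summable (\<lambda>k. ?f (Suc k) t - ?f k t)"
    proof (rule summable_comparison_test')
      show "summable (\<lambda>k. Lc * ?E * a k + H * ?E * w k)"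
        by (intro summable_add summable_mult a_summable w_summable)
      fix k
      have "\<bar>?f (Suc k) t - ?f k t\<bar> \<le> \<bar>?f k (t - a k) - ?f k t\<bar> + w k * \<bar>?f k t\<bar>"
        using w_nonneg[of k] abs_triangle_ineq4[of "?f k (t - a k) - ?f k t" "w k * ?f k t"]
        by (simp add: abs_mult algebra_simps)
      also have "\<dots> \<le> Lc * ?E * a k + w k * (H * ?E)"
        using shift_filter_lipschitz[of k "t - a k" t] a_nonneg[of k] w_nonneg[of k]
          shift_filter_bound[of k t]
        by (intro add_mono mult_left_mono) auto
      finally show "norm (?f (Suc k) t - ?f k t) \<le> Lc * ?E * a k + H * ?E * w k"
        by (simp add: algebra_simps)
    qed
    then have "convergent (\<lambda>n. \<Sum>k<n. ?f (Suc k) t - ?f k t)"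
      by (simp add: summable_iff_convergent)
    then have "convergent (\<lambda>n. ?f n t - ?f 0 t)"
      by (simp only: sum_lessThan_telescope[where f = "\<lambda>n. ?f n t"])
    then show ?thesis
      using convergent_diff_const_right_iff by blast
  qed
  then obtain G where G: "\<And>t. (\<lambda>k. ?f k t) \<longlonglongrightarrow> G t"
    unfolding convergent_def by metis
  have bound: "\<bar>G t\<bar> \<le> H * ?E" for t
    using shift_filter_bound by (intro Lim_bounded[OF tendsto_rabs[OF G]]) auto
  have "\<bar>G t - G t'\<bar> \<le> Lc * ?E * \<bar>t - t'\<bar>" for t t'
    using shift_filter_lipschitz
    by (intro Lim_bounded[OF tendsto_rabs[OF tendsto_diff[OF G G]]]) auto
  then have cont: "continuous_on UNIV G"
    by (rule lipschitz_continuous_on)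
  have supp: "G t = 0" if "t \<notin> {0..e + suminf a}" for t
    using G[of t] by (simp add: shift_filter_support[OF that] LIMSEQ_const_iff)
  have "(\<lambda>k. LINT t|lborel. exp (- z * t) * ?f k t) \<longlonglongrightarrow> (LINT t|lborel. exp (- z * t) * G t)" for z
  proof (rule integral_dominated_convergence)
    let ?S = "{0..e + suminf a}"
    show "(\<lambda>t. exp (- z * t) * G t) \<in> borel_measurable lborel"
      using cont by (auto intro!: borel_measurable_continuous_onI continuous_intros)
    show "(\<lambda>t. exp (- z * t) * ?f k t) \<in> borel_measurable lborel" for k
      using shift_filter_continuous[of k]
      by (auto intro!: borel_measurable_continuous_onI continuous_intros)
    show "integrable lborel (\<lambda>t. indicator ?S t *\<^sub>R (exp (- z * t) * (H * ?E)))"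
      by (intro borel_integrable_compact) (auto intro!: continuous_intros)
    show "AE t in lborel. (\<lambda>k. exp (- z * t) * ?f k t) \<longlonglongrightarrow> exp (- z * t) * G t"
      using G by (intro AE_I2 tendsto_intros)
    have "norm (exp (- z * t) * ?f k t) \<le> indicator ?S t *\<^sub>R (exp (- z * t) * (H * ?E))" for k t
      using shift_filter_support[of t k] shift_filter_bound[of k t]
      by (cases "t \<in> ?S") (auto simp: abs_mult)
    then show "AE t in lborel. norm (exp (- z * t) * ?f k t) \<le>
        indicator ?S t *\<^sub>R (exp (- z * t) * (H * ?E))" for k
      by simp
  qed
  then show ?thesis
    using that[of G] cont bound supp unfolding shift_filter_laplace by blast
qed

end

subsection \<open>Biorthogonal families of exponentials\<close>

text \<open>On the middle half of the support, of length \<open>e / 2\<close>, the tent is at least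
  \<open>e / 4\<close> and the exponential at least \<open>exp (- (e * z))\<close>.\<close>

lemma tent_laplace_lower_bound:
  fixes e z :: real
  assumes "e > 0" "z \<ge> 0"
  shows "exp (- (e * z)) * (e\<^sup>2 / 8) \<le> (LINT t|lborel. exp (- z * t) * max 0 (e / 2 - \<bar>t - e / 2\<bar>))"
proof -
  have mono: "(LINT t|lborel. indicator {e/4..3*e/4} t *\<^sub>R (exp (- (e * z)) * (e / 4)))
      \<le> (LINT t|lborel. exp (- z * t) * max 0 (e / 2 - \<bar>t - e / 2\<bar>))"
  proof (rule integral_mono)
    show "integrable lborel (\<lambda>t. indicator {e/4..3*e/4} t *\<^sub>R (exp (- (e * z)) * (e / 4)))"
      by (intro borel_integrable_compact) auto
    show "integrable lborel (\<lambda>t. exp (- z * t) * max 0 (e / 2 - \<bar>t - e / 2\<bar>))"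
      by (rule integrable_lborel_compact_support[where x = 0 and y = e])
        (auto intro!: continuous_intros)
    show "indicator {e/4..3*e/4} t *\<^sub>R (exp (- (e * z)) * (e / 4))
        \<le> exp (- z * t) * max 0 (e / 2 - \<bar>t - e / 2\<bar>)" for t
    proof (cases "t \<in> {e/4..3*e/4}")
      case True
      then have "z * t \<le> z * e" using assms by (intro mult_left_mono) auto
      moreover have "\<bar>t - e / 2\<bar> \<le> e / 4" using True by (intro abs_leI) auto
      then have "e / 4 \<le> max 0 (e / 2 - \<bar>t - e / 2\<bar>)" by (intro max.coboundedI2) linarith
      ultimately have "exp (- (e * z)) * (e / 4) \<le> exp (- z * t) * max 0 (e / 2 - \<bar>t - e / 2\<bar>)"
        using assms by (intro mult_mono) (auto simp: mult.commute)
      then show ?thesis using True by simp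
    qed auto
  qed
  have eq: "(LINT t|lborel. indicator {e/4..3*e/4} t *\<^sub>R (exp (- (e * z)) * (e / 4))) = exp (- (e * z)) * (e\<^sup>2 / 8)"
    using assms by (simp add: power2_eq_square field_simps)
  show ?thesis using mono unfolding eq .
qed

section \<open>Convergence and elementary estimates for exponentials and products\<close>

lemma summable_inverse_Suc_square: "summable (\<lambda>i. 1 / real (Suc i) ^ 2)"
  using inverse_power_summable[of 2, where 'a = real] summable_Suc_iff[of "\<lambda>i. 1 / real i ^ 2"]
  by (simp add: inverse_eq_divide)

lemma summable_exp_neg_powr:
  fixes c k :: real
  assumes "c > 0" "k > 0"
  shows "summable (\<lambda>i. exp (- (c * real (Suc i) powr k)))"
proof (rule summable_comparison_test_ev[OF _ summable_inverse_Suc_square])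
  show "\<forall>\<^sub>F i in sequentially. norm (exp (- (c * real (Suc i) powr k))) \<le> (1 / real (Suc i) ^ 2)"
    unfolding real_norm_def abs_exp_cancel
    using assms by real_asymp
qed

lemma superlinear_minus_linear_log:
  fixes b c r :: real
  assumes "b > 1" "c > 0"
  shows "filterlim (\<lambda>n. c * real (Suc n) powr b -
    K * real (Suc n) * (C + r * ln (real (Suc n)))) at_top sequentially"
  using assms by real_asymp

text \<open>Turns a limit at infinity into a bound without exceptional indices, since the finitely
  many early terms have a minimum.\<close>

lemma filterlim_at_top_bounded_below:
  fixes X :: "nat \<Rightarrow> real"
  assumes "filterlim X at_top sequentially"
  obtains c where "\<And>n. c \<le> X n"
proof -
  obtain N where N: "\<And>n. n \<ge> N \<Longrightarrow> 0 \<le> X n"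
    using assms unfolding filterlim_at_top eventually_sequentially by blast
  have "min 0 (Min (X ` {..N})) \<le> X n" for n
  proof (cases "n \<le> N")
    case True
    then have "Min (X ` {..N}) \<le> X n" by (intro Min_le) auto
    then show ?thesis by simp
  next
    case False
    then show ?thesis using N[of n] by simp
  qed
  then show ?thesis by (rule that)
qed

text \<open>Each factor satisfies
  \<open>1 / (1 - v) = 1 + v / (1 - v) \<le> exp (v / (1 - \<rho>))\<close>. The resulting bound
  does not depend on \<open>S\<close>, so it survives any choice of finitely many factors.\<close>

lemma prod_one_minus_ge:
  fixes v :: "nat \<Rightarrow> real"
  assumes v: "\<And>i. 0 \<le> v i" "\<And>i. v i \<le> \<rho>" and "\<rho> < 1" "summable v" "finite S"
  shows "exp (- (suminf v / (1 - \<rho>))) \<le> (\<Prod>i\<in>S. 1 - v i)"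
proof -
  have factor: "exp (- (v i / (1 - \<rho>))) \<le> 1 - v i" for i
  proof -
    have "1 + v i / (1 - v i) \<le> 1 + v i / (1 - \<rho>)"
      using v[of i] \<open>\<rho> < 1\<close> by (intro add_left_mono divide_left_mono) auto
    also have "\<dots> \<le> exp (v i / (1 - \<rho>))"
      by (rule exp_ge_add_one_self)
    finally have "1 / (1 - v i) \<le> exp (v i / (1 - \<rho>))"
      using v[of i] \<open>\<rho> < 1\<close> by (simp add: divide_simps split: if_splits)
    then show ?thesis
      using v[of i] \<open>\<rho> < 1\<close> by (simp add: exp_minus divide_simps mult.commute split: if_splits)
  qed
  have "(\<Sum>i\<in>S. v i / (1 - \<rho>)) \<le> suminf v / (1 - \<rho>)"
    using assms by (simp add: sum_le_suminf divide_right_mono flip: sum_divide_distrib)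
  then have "exp (- (suminf v / (1 - \<rho>))) \<le> exp (\<Sum>i\<in>S. - (v i / (1 - \<rho>)))"
    by (simp add: sum_negf)
  also have "\<dots> = (\<Prod>i\<in>S. exp (- (v i / (1 - \<rho>))))"
    using \<open>finite S\<close> by (rule exp_sum)
  also have "\<dots> \<le> (\<Prod>i\<in>S. 1 - v i)"
    using factor by (intro prod_mono) auto
  finally show ?thesis .
qed

lemma one_minus_exp_ge_half:
  fixes x :: real
  assumes "0 \<le> x" "x \<le> 1"
  shows "x / 2 \<le> 1 - exp (- x)"
proof -
  have "exp (- x) \<le> 1 / (1 + x)"
    using exp_ge_add_one_self[of x] assms by (simp add: exp_minus inverse_eq_divide frac_le)
  moreover have "x / 2 \<le> 1 - 1 / (1 + x)"
  proof -
    have "x * x \<le> x" using assms by (simp add: mult_left_le)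
    then show ?thesis using assms by (simp add: field_simps)
  qed
  ultimately show ?thesis by simp
qed

section \<open>Separation of the eigenvalues and biorthogonal families\<close>

context
  fixes lam :: "nat \<Rightarrow> real" and m0 m1 \<beta> \<theta> s :: real
  assumes m0: "m0 > 0" and \<beta>: "\<beta> > 1" and \<theta>: "\<theta> > 0" and s: "s \<ge> 0"
    and lower: "\<And>n. m0 * real (Suc n) powr \<beta> \<le> lam n"
    and upper: "\<And>n. lam n \<le> m1 * real (Suc n) powr \<beta>"
    and gap: "\<And>n. lam (Suc n) - lam n \<ge> \<theta> * real (Suc n) powr (- s)"
begin

lemma lam_pos: "lam n > 0"
  using m0 by (intro less_le_trans[OF _ lower]) simp

lemma lam_less_Suc: "lam n < lam (Suc n)"
proof -
  have "0 < \<theta> * real (Suc n) powr (- s)" using \<theta> by simp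
  then show ?thesis using gap[of n] by linarith
qed

lemma lam_mono: "i \<le> j \<Longrightarrow> lam i \<le> lam j"
  by (rule lift_Suc_mono_le[of lam, OF less_imp_le[OF lam_less_Suc]])

text \<open>A single neighbouring gap suffices: the one after \<open>n\<close> if
  \<open>i > n\<close>, the one after \<open>i\<close> if \<open>i < n\<close>. In the second case
  the gap bound at \<open>i\<close> is at least the bound at \<open>n\<close>, because the power
  with exponent \<open>- s\<close> decreases.\<close>

lemma gap_all:
  assumes "i \<noteq> n"
  shows "\<theta> * real (Suc n) powr (- s) \<le> \<bar>lam i - lam n\<bar>"
proof (cases "i < n")
  case True
  have "\<theta> * real (Suc n) powr (- s) \<le> \<theta> * real (Suc i) powr (- s)"
    using True \<theta> s by (intro mult_left_mono powr_mono2') auto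
  also have "\<dots> \<le> lam (Suc i) - lam i" by (rule gap)
  also have "\<dots> \<le> lam n - lam i" using True lam_mono[of "Suc i" n] by simp
  finally show ?thesis by linarith
next
  case False
  then have "lam (Suc n) \<le> lam i" using assms by (intro lam_mono) simp
  then show ?thesis using gap[of n] by linarith
qed

context
  fixes c \<gamma> :: real
  assumes c: "c > 0" and \<gamma>: "1 < \<gamma>" "\<gamma> < \<beta>"
begin

text \<open>With \<open>\<gamma> < \<beta>\<close> the products of eigenvalue and shift still grow
  like a positive power. This makes the weights \<open>exp (- (lam i * a i))\<close> summable and
  controls the factors with large index.\<close>

lemma lam_times_ge: "m0 * c * real (Suc i) powr (\<beta> - \<gamma>) \<le> lam i * (c * real (Suc i) powr (- \<gamma>))"
proof -
  have "m0 * c * real (Suc i) powr (\<beta> - \<gamma>) = (m0 * real (Suc i) powr \<beta>) * (c * real (Suc i) powr (- \<gamma>))"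
    using powr_add[of "real (Suc i)" \<beta> "- \<gamma>"] by (simp only: add_uminus_conv_diff mult.assoc mult.left_commute mult.commute)
  also have "\<dots> \<le> lam i * (c * real (Suc i) powr (- \<gamma>))"
    using c by (intro mult_right_mono lower) auto
  finally show ?thesis .
qed

text \<open>Only \<open>O(n)\<close> factors are concerned and the gap makes each of them at least a negative power of
  \<open>n\<close>, so the product is at least \<open>exp (- O(n ln n))\<close>, and \<open>\<beta> > 1\<close>.\<close>

lemma near_product_lower_bound:
  fixes K :: nat
  assumes "\<delta> > 0" "K \<ge> 1"
  obtains \<kappa> where "\<kappa> > 0"
    "\<And>n S. n \<notin> S \<Longrightarrow> S \<subseteq> {..<K * Suc n} \<Longrightarrow>
      \<kappa> * exp (- (\<delta> * lam n)) \<le> (\<Prod>i\<in>S. 1 - exp (- (\<bar>lam i - lam n\<bar> * (c * real (Suc i) powr (- \<gamma>)))))"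
proof -
  \<comment> \<open>\<open>x n\<close> bounds all the exponents with \<open>i < K * Suc n\<close>
    from below: the gap contributes \<open>s\<close> to \<open>r\<close>, and the smallest shift
    contributes \<open>\<gamma>\<close> and the power of \<open>K\<close>. The minimum with 1 keeps
    \<open>x n\<close> in the range of \<open>one_minus_exp_ge_half\<close>.\<close>
  define c1 where "c1 = min 1 (\<theta> * c * real K powr (- \<gamma>))"
  define r where "r = s + \<gamma>"
  define x where "x = (\<lambda>n. c1 * real (Suc n) powr (- r))"
  have c1: "0 < c1" "c1 \<le> 1"
    using \<theta> c \<open>K \<ge> 1\<close> by (auto simp: c1_def)
  have r: "r > 0" using s \<gamma> by (simp add: r_def)
  have x: "0 < x n" "x n \<le> 1" for n
  proof -
    have "real (Suc n) powr (- r) \<le> 1"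
      using powr_mono[of "- r" 0 "real (Suc n)"] r by simp
    then show "x n \<le> 1"
      using c1 by (auto simp: x_def intro!: mult_le_one)
    show "0 < x n" using c1 by (simp add: x_def)
  qed
  have factor: "x n / 2 \<le> 1 - exp (- (\<bar>lam i - lam n\<bar> * (c * real (Suc i) powr (- \<gamma>))))"
    if "i \<noteq> n" "i < K * Suc n" for i n
  proof -
    have "x n \<le> \<theta> * c * real K powr (- \<gamma>) * real (Suc n) powr (- r)"
      by (simp add: x_def c1_def mult_right_mono)
    also have "real (Suc n) powr (- r) = real (Suc n) powr (- s) * real (Suc n) powr (- \<gamma>)"
      by (simp add: r_def flip: powr_add)
    also have "\<theta> * c * real K powr (- \<gamma>) * (real (Suc n) powr (- s) * real (Suc n) powr (- \<gamma>)) =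
        \<theta> * real (Suc n) powr (- s) * (c * real (K * Suc n) powr (- \<gamma>))"
      unfolding of_nat_mult by (subst powr_mult) (simp_all only: mult_ac of_nat_0_le_iff)
    also have "\<dots> \<le> \<bar>lam i - lam n\<bar> * (c * real (Suc i) powr (- \<gamma>))"
      using that c \<gamma> by (intro mult_mono gap_all powr_mono2' of_nat_mono) auto
    finally have "exp (- (\<bar>lam i - lam n\<bar> * (c * real (Suc i) powr (- \<gamma>)))) \<le> exp (- x n)"
      by simp
    then show ?thesis
      using one_minus_exp_ge_half[of "x n"] x[of n] by linarith
  qed
  \<comment> \<open>With \<open>lam n\<close> replaced by its lower bound, this is
    \<open>\<delta> * lam n\<close> plus the logarithm of \<open>(x n / 2) ^ (K * Suc n)\<close>,
    the worst case in which every near index occurs with the smallest allowed factor.\<close>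
  have "filterlim (\<lambda>n. \<delta> * m0 * real (Suc n) powr \<beta> -
      real K * real (Suc n) * (- ln (c1 / 2) + r * ln (real (Suc n)))) at_top sequentially"
    using m0 \<open>\<delta> > 0\<close> by (intro superlinear_minus_linear_log \<beta>) auto
  then obtain C where C: "\<And>n. C \<le> \<delta> * m0 * real (Suc n) powr \<beta> -
      real K * real (Suc n) * (- ln (c1 / 2) + r * ln (real (Suc n)))"
    by (rule filterlim_at_top_bounded_below) blast
  show ?thesis
  proof (rule that[of "exp C"])
    fix n S assume S: "n \<notin> S" "S \<subseteq> {..<K * Suc n}"
    have "C \<le> \<delta> * lam n + real (K * Suc n) * ln (x n / 2)"
    proof -
      have "\<delta> * m0 * real (Suc n) powr \<beta> \<le> \<delta> * lam n"
        using lower[of n] \<open>\<delta> > 0\<close> by (simp add: mult.assoc)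
      moreover have ln_x: "ln (x n / 2) = ln (c1 / 2) - r * ln (real (Suc n))"
      proof -
        have "ln (c1 / 2 * real (Suc n) powr (- r)) = ln (c1 / 2) + ln (real (Suc n) powr (- r))"
          using c1 by (intro ln_mult_pos) auto
        then show ?thesis by (simp add: x_def ln_powr)
      qed
      moreover have "real (K * Suc n) * ln (x n / 2) =
          - (real K * real (Suc n) * (- ln (c1 / 2) + r * ln (real (Suc n))))"
        unfolding ln_x of_nat_mult by (simp only: minus_add_distrib minus_mult_right) simp
      ultimately show ?thesis using C[of n] by linarith
    qed
    then have "exp C * exp (- (\<delta> * lam n)) \<le> exp (real (K * Suc n) * ln (x n / 2))"
      by (simp flip: exp_add)
    also have "\<dots> = (x n / 2) ^ (K * Suc n)"
      using x[of n] by (simp only: exp_of_nat_mult) simp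
    \<comment> \<open>The base is below 1, so having fewer than \<open>K * Suc n\<close> factors
      only helps.\<close>
    also have "\<dots> \<le> (x n / 2) ^ card S"
      using x[of n] card_mono[OF _ S(2)] by (intro power_decreasing) auto
    also have "\<dots> = (\<Prod>i\<in>S. x n / 2)" by simp
    also have "\<dots> \<le> (\<Prod>i\<in>S. 1 - exp (- (\<bar>lam i - lam n\<bar> * (c * real (Suc i) powr (- \<gamma>)))))"
    proof (rule prod_mono)
      fix i assume "i \<in> S"
      then have "i \<noteq> n" "i < K * Suc n" using S by auto
      from factor[OF this] x[of n]
      show "0 \<le> x n / 2 \<and> x n / 2 \<le> 1 - exp (- (\<bar>lam i - lam n\<bar> * (c * real (Suc i) powr (- \<gamma>))))"
        by simp
    qed
    finally show "exp C * exp (- (\<delta> * lam n)) \<le>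
      (\<Prod>i\<in>S. 1 - exp (- (\<bar>lam i - lam n\<bar> * (c * real (Suc i) powr (- \<gamma>)))))" .
  qed simp
qed

text \<open>Far beyond \<open>n\<close> the eigenvalues are at least \<open>2 * lam n\<close>, hence
  \<open>\<bar>lam i - lam n\<bar>\<close> is at least \<open>lam i / 2\<close>. The factors are
  then bounded below by a sequence in which \<open>n\<close> no longer occurs, which makes
  \<open>\<kappa>\<close> uniform.\<close>

lemma far_product_lower_bound:
  obtains \<kappa> and K :: nat where "\<kappa> > 0" "K \<ge> 1"
    "\<And>n S. finite S \<Longrightarrow> S \<subseteq> {K * Suc n..} \<Longrightarrow>
      \<kappa> \<le> (\<Prod>i\<in>S. 1 - exp (- (\<bar>lam i - lam n\<bar> * (c * real (Suc i) powr (- \<gamma>)))))"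
proof -
  define v where "v = (\<lambda>i. exp (- (m0 * c / 2 * real (Suc i) powr (\<beta> - \<gamma>))))"
  \<comment> \<open>The largest of the \<open>v i\<close>, attained at \<open>i = 0\<close>.\<close>
  define \<rho> where "\<rho> = exp (- (m0 * c / 2))"
  have \<rho>: "\<rho> < 1" using m0 c by (simp add: \<rho>_def)
  have v: "0 \<le> v i" "v i \<le> \<rho>" for i
    using m0 c \<gamma> ge_one_powr_ge_zero[of "real (Suc i)" "\<beta> - \<gamma>"] by (simp_all add: v_def \<rho>_def)
  have v_summable: "summable v"
    unfolding v_def using m0 c \<gamma> by (intro summable_exp_neg_powr) auto
  \<comment> \<open>Since \<open>K powr \<beta> \<ge> K \<ge> 2 * m1 / m0\<close>, the two power
    bounds alone show that the eigenvalue at least doubles from index \<open>n\<close> to any index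
    from \<open>K * Suc n\<close> on.\<close>
  define K where "K = nat \<lceil>max 1 (2 * m1 / m0)\<rceil>"
  have K: "K \<ge> 1" "2 * m1 / m0 \<le> real K"
    unfolding K_def by linarith+
  have double: "2 * lam n \<le> lam i" if "K * Suc n \<le> i" for i n
  proof -
    have "2 * lam n \<le> 2 * m1 * real (Suc n) powr \<beta>" using upper[of n] by simp
    also have "\<dots> \<le> m0 * real K * real (Suc n) powr \<beta>"
      using K m0 by (intro mult_right_mono) (auto simp: field_simps)
    also have "\<dots> \<le> m0 * real K powr \<beta> * real (Suc n) powr \<beta>"
      using K m0 \<beta> powr_mono[of 1 \<beta> "real K"] by (intro mult_right_mono mult_left_mono) auto
    also have "\<dots> = m0 * real (K * Suc n) powr \<beta>"
      unfolding of_nat_mult by (subst powr_mult) auto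
    also have "\<dots> \<le> m0 * real (Suc i) powr \<beta>"
      using m0 \<beta> that by (intro mult_left_mono powr_mono2 of_nat_mono) auto
    also have "\<dots> \<le> lam i" by (rule lower)
    finally show ?thesis .
  qed
  show ?thesis
  proof (rule that[of "exp (- (suminf v / (1 - \<rho>)))" K])
    fix n S assume S: "finite S" "S \<subseteq> {K * Suc n..}"
    have "exp (- (suminf v / (1 - \<rho>))) \<le> (\<Prod>i\<in>S. 1 - v i)"
      by (rule prod_one_minus_ge[OF v \<rho> v_summable S(1)])
    also have "\<dots> \<le> (\<Prod>i\<in>S. 1 - exp (- (\<bar>lam i - lam n\<bar> * (c * real (Suc i) powr (- \<gamma>)))))"
    proof (intro prod_mono conjI)
      fix i assume "i \<in> S"
      then have "K * Suc n \<le> i" using S(2) by auto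
      then have "2 * lam n \<le> lam i" by (rule double)
      then have "lam i / 2 \<le> \<bar>lam i - lam n\<bar>" by linarith
      then have "lam i / 2 * (c * real (Suc i) powr (- \<gamma>)) \<le> \<bar>lam i - lam n\<bar> * (c * real (Suc i) powr (- \<gamma>))"
        using c by (intro mult_right_mono) auto
      then show "1 - v i \<le> 1 - exp (- (\<bar>lam i - lam n\<bar> * (c * real (Suc i) powr (- \<gamma>))))"
        using lam_times_ge[of i] by (simp add: v_def)
      show "0 \<le> 1 - v i" using v[of i] \<rho> by linarith
    qed
    finally show "exp (- (suminf v / (1 - \<rho>))) \<le>
        (\<Prod>i\<in>S. 1 - exp (- (\<bar>lam i - lam n\<bar> * (c * real (Suc i) powr (- \<gamma>)))))" .
  qed (use K in auto)
qed

text \<open>The index set is cut at \<open>K * Suc n\<close>. The far part dictates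
  \<open>K\<close>, and the near part tolerates any \<open>K\<close>, at the cost of its constant
  only.\<close>

lemma product_lower_bound:
  assumes "\<delta> > 0"
  obtains \<kappa> where "\<kappa> > 0"
    "\<And>n S. finite S \<Longrightarrow> n \<notin> S \<Longrightarrow>
      \<kappa> * exp (- (\<delta> * lam n)) \<le> (\<Prod>i\<in>S. 1 - exp (- (\<bar>lam i - lam n\<bar> * (c * real (Suc i) powr (- \<gamma>)))))"
proof -
  let ?f = "\<lambda>n i. 1 - exp (- (\<bar>lam i - lam n\<bar> * (c * real (Suc i) powr (- \<gamma>))))"
  obtain \<kappa>2 and K :: nat where far: "\<kappa>2 > 0" "K \<ge> 1"
    "\<And>n S. finite S \<Longrightarrow> S \<subseteq> {K * Suc n..} \<Longrightarrow> \<kappa>2 \<le> prod (?f n) S"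
    using far_product_lower_bound by blast
  obtain \<kappa>1 where near: "\<kappa>1 > 0"
    "\<And>n S. n \<notin> S \<Longrightarrow> S \<subseteq> {..<K * Suc n} \<Longrightarrow> \<kappa>1 * exp (- (\<delta> * lam n)) \<le> prod (?f n) S"
    using near_product_lower_bound[OF assms far(2)] by blast
  show ?thesis
  proof (rule that[of "\<kappa>1 * \<kappa>2"])
    fix n and S :: "nat set" assume S: "finite S" "n \<notin> S"
    have "(\<kappa>1 * exp (- (\<delta> * lam n))) * \<kappa>2 \<le>
        prod (?f n) (S \<inter> {..<K * Suc n}) * prod (?f n) (S - {..<K * Suc n})"
      using S near(1) far(1)
      by (intro mult_mono near(2) far(3) order_trans[OF _ near(2)]) auto
    also have "\<dots> = prod (?f n) S"
      using S(1) by (rule prod.Int_Diff[symmetric])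
    finally show "\<kappa>1 * \<kappa>2 * exp (- (\<delta> * lam n)) \<le> prod (?f n) S"
      by (simp add: mult_ac)
  qed (use near far in simp)
qed

end

lemma biorthogonal_family:
  fixes \<epsilon> :: real
  assumes "\<epsilon> > 0"
  obtains \<psi> :: "nat \<Rightarrow> real \<Rightarrow> real" and K where "\<And>n. continuous_on UNIV (\<psi> n)"
    "\<And>n t. t \<notin> {0..\<epsilon>} \<Longrightarrow> \<psi> n t = 0"
    "\<And>n t. \<bar>\<psi> n t\<bar> \<le> K * exp (\<epsilon> * lam n)"
    "\<And>m n. (LINT t|lborel. exp (- lam m * t) * \<psi> n t) = (if m = n then 1 else 0)"
proof -
  \<comment> \<open>Two budgets have to fit into \<open>\<epsilon>\<close>. The support has length
    at most \<open>2 * e\<close>, one \<open>e\<close> for the tent and one for all shifts. The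
    diagonal value loses \<open>exp (- (3 * e * lam n))\<close>: one \<open>e\<close> for the
    exponentials \<open>exp (- lam n * a i)\<close>, one for the product over the gaps, one for the
    tent.\<close>
  define e where "e = \<epsilon> / 4"
  have e: "e > 0" using assms by (simp add: e_def)
  define \<gamma> where "\<gamma> = (1 + \<beta>) / 2"
  have \<gamma>: "1 < \<gamma>" "\<gamma> < \<beta>" using \<beta> by (auto simp: \<gamma>_def field_simps)
  have powr_summable: "summable (\<lambda>i. real (Suc i) powr (- \<gamma>))"
    using summable_real_powr_iff[of "- \<gamma>"] \<gamma> summable_Suc_iff[of "\<lambda>i. real i powr (- \<gamma>)"] by simp
  \<comment> \<open>Normalises the shifts so that they add up to exactly \<open>e\<close>.\<close>
  define c where "c = e / (\<Sum>i. real (Suc i) powr (- \<gamma>))"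
  have "(\<Sum>i. real (Suc i) powr (- \<gamma>)) > 0"
    by (intro suminf_pos powr_summable) simp
  then have c: "c > 0" "c * (\<Sum>i. real (Suc i) powr (- \<gamma>)) = e"
    using e by (simp_all add: c_def)
  define a where "a = (\<lambda>i. c * real (Suc i) powr (- \<gamma>))"
  have a: "a i \<ge> 0" for i using c by (simp add: a_def)
  have a_summable: "summable a" and a_suminf: "suminf a = e"
    unfolding a_def using summable_mult[OF powr_summable, of c] suminf_mult[OF powr_summable, of c] c(2)
    by (simp_all only:)
  define w where "w = (\<lambda>i. exp (- (lam i * a i)))"
  have w: "w i \<ge> 0" for i by (simp add: w_def)
  have w_summable: "summable w"
  proof (rule summable_comparison_test'[OF summable_exp_neg_powr[of "m0 * c" "\<beta> - \<gamma>"]])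
    show "norm (w i) \<le> exp (- (m0 * c * real (Suc i) powr (\<beta> - \<gamma>)))" for i
      using lam_times_ge[OF c(1) \<gamma>, of i] by (simp add: w_def a_def)
  qed (use m0 c \<gamma> in auto)
  define h where "h = (\<lambda>t. max 0 (e / 2 - \<bar>t - e / 2\<bar>))"
  define W where "W = e * exp (suminf w)"
  obtain \<kappa> where \<kappa>: "\<kappa> > 0" "\<And>n S. finite S \<Longrightarrow> n \<notin> S \<Longrightarrow>
      \<kappa> * exp (- (e * lam n)) \<le> (\<Prod>i\<in>S. 1 - exp (- (\<bar>lam i - lam n\<bar> * a i)))"
    using product_lower_bound[OF c(1) \<gamma> e] unfolding a_def by blast
  define P where "P = (\<lambda>n k z. \<Prod>i<k. exp (- z * (a(n := 0)) i) - (w(n := 0)) i)"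
  define I where "I = (\<lambda>z. LINT t|lborel. exp (- z * t) * h t)"
  have "\<exists>G. continuous_on UNIV G \<and> (\<forall>t. \<bar>G t\<bar> \<le> W) \<and> (\<forall>t. t \<notin> {0..2 * e} \<longrightarrow> G t = 0) \<and>
      (\<forall>z. (\<lambda>k. P n k z * I z) \<longlonglongrightarrow> (LINT t|lborel. exp (- z * t) * G t))" for n
  proof -
    have sa: "summable (a(n := 0))"
      by (rule summable_comparison_test'[OF a_summable, of 0]) (use a in auto)
    have sw: "summable (w(n := 0))"
      by (rule summable_comparison_test'[OF w_summable, of 0]) (use w in auto)
    have le: "suminf (a(n := 0)) \<le> e" "suminf (w(n := 0)) \<le> suminf w"
      unfolding a_suminf[symmetric] using a w by (auto intro!: suminf_le sa sw a_summable w_summable)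
    obtain G where G: "continuous_on UNIV G" "\<And>t. \<bar>G t\<bar> \<le> e * exp (suminf (w(n := 0)))"
      "\<And>t. t \<notin> {0..e + suminf (a(n := 0))} \<Longrightarrow> G t = 0"
      "\<And>z. (\<lambda>k. P n k z * I z) \<longlonglongrightarrow> (LINT t|lborel. exp (- z * t) * G t)"
      unfolding P_def I_def
    proof (rule shift_filter_limit[of "a(n := 0)" "w(n := 0)" h e 1 e])
      show "\<bar>h t - h t'\<bar> \<le> 1 * \<bar>t - t'\<bar>" for t t'
        unfolding h_def by (auto simp: max_def abs_if)
    qed (use a w sa sw e in \<open>auto simp: h_def\<close>)
    have "\<bar>G t\<bar> \<le> W" for t
      unfolding W_def using e le by (intro order_trans[OF G(2)] mult_left_mono) auto
    moreover have "G t = 0" if "t \<notin> {0..2 * e}" for t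
      using that le by (intro G(3)) auto
    ultimately show ?thesis using G(1,4) by blast
  qed
  then obtain G where G: "\<And>n. continuous_on UNIV (G n)" "\<And>n t. \<bar>G n t\<bar> \<le> W"
    "\<And>n t. t \<notin> {0..2 * e} \<Longrightarrow> G n t = 0"
    "\<And>n z. (\<lambda>k. P n k z * I z) \<longlonglongrightarrow> (LINT t|lborel. exp (- z * t) * G n t)"
    by metis
  define J where "J = (\<lambda>n m. LINT t|lborel. exp (- lam m * t) * G n t)"
  have J_off: "J n m = 0" if "m \<noteq> n" for m n
  proof -
    \<comment> \<open>The weight \<open>w m\<close> cancels \<open>exp (- lam m * a m)\<close>, and
      the update at \<open>n\<close> leaves this factor alone since \<open>m \<noteq> n\<close>. It
      is present as soon as \<open>k > m\<close>.\<close>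
    have "P n k (lam m) * I (lam m) = 0" if "k > m" for k
    proof -
      have "P n k (lam m) = 0"
        unfolding P_def using that \<open>m \<noteq> n\<close> by (intro prod_zero bexI[of _ m]) (auto simp: w_def)
      then show ?thesis by simp
    qed
    then have "(\<lambda>k. P n k (lam m) * I (lam m)) \<longlonglongrightarrow> 0"
      by (intro tendsto_eventually eventually_sequentiallyI[of "Suc m"]) auto
    then show ?thesis
      using G(4)[of n "lam m"] LIMSEQ_unique by (auto simp: J_def)
  qed
  have J_diag: "\<kappa> * (e\<^sup>2 / 8) * exp (- (3 * e * lam n)) \<le> \<bar>J n n\<bar>" for n
  proof -
    have "\<kappa> * (e\<^sup>2 / 8) * exp (- (3 * e * lam n)) \<le> \<bar>P n k (lam n) * I (lam n)\<bar>" for k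
    proof -
      let ?S = "{..<k} - {n}"
      have "P n k (lam n) = (\<Prod>i\<in>?S. exp (- lam n * a i) - w i)"
        unfolding P_def by (intro prod.mono_neutral_cong_right) auto
      then have "\<bar>P n k (lam n)\<bar> = (\<Prod>i\<in>?S. \<bar>exp (- lam n * a i) - w i\<bar>)"
        by (simp add: abs_prod)
      \<comment> \<open>For \<open>lam i \<ge> lam n\<close> this is an identity, obtained by
        extracting \<open>exp (- lam n * a i)\<close>. For \<open>lam i < lam n\<close> the sign
        flips and \<open>w i\<close> is extracted instead, which is at least as large.\<close>
      also have "\<dots> \<ge> (\<Prod>i\<in>?S. exp (- lam n * a i) * (1 - exp (- (\<bar>lam i - lam n\<bar> * a i))))"
      proof (intro prod_mono conjI)
        fix i
        have "exp (- (\<bar>lam i - lam n\<bar> * a i)) \<le> 1" using a[of i] by simp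
        then show "0 \<le> exp (- lam n * a i) * (1 - exp (- (\<bar>lam i - lam n\<bar> * a i)))" by simp
        show "exp (- lam n * a i) * (1 - exp (- (\<bar>lam i - lam n\<bar> * a i))) \<le> \<bar>exp (- lam n * a i) - w i\<bar>"
        proof (cases "lam n \<le> lam i")
          case True
          then show ?thesis
            by (intro order_trans[OF _ abs_ge_self]) (simp add: w_def algebra_simps flip: exp_add)
        next
          case False
          then have "exp (- lam n * a i) \<le> w i"
            using a[of i] by (simp add: w_def mult_right_mono)
          moreover have "exp (- lam n * a i) * (1 - exp (- (\<bar>lam i - lam n\<bar> * a i))) \<le>
              w i * (1 - exp (- (\<bar>lam i - lam n\<bar> * a i)))"
            using calculation \<open>exp (- (\<bar>lam i - lam n\<bar> * a i)) \<le> 1\<close> by (intro mult_right_mono) auto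
          moreover have "w i * (1 - exp (- (\<bar>lam i - lam n\<bar> * a i))) = w i - exp (- lam n * a i)"
            using False by (simp add: w_def algebra_simps flip: exp_add)
          ultimately show ?thesis by linarith
        qed
      qed
      also have "(\<Prod>i\<in>?S. exp (- lam n * a i) * (1 - exp (- (\<bar>lam i - lam n\<bar> * a i)))) =
          exp (- lam n * sum a ?S) * (\<Prod>i\<in>?S. 1 - exp (- (\<bar>lam i - lam n\<bar> * a i)))"
        by (simp add: prod.distrib exp_sum sum_distrib_left flip: sum_negf)
      finally have "exp (- lam n * sum a ?S) * (\<Prod>i\<in>?S. 1 - exp (- (\<bar>lam i - lam n\<bar> * a i)))
          \<le> \<bar>P n k (lam n)\<bar>" .
      moreover have "exp (- (e * lam n)) * (\<kappa> * exp (- (e * lam n))) \<le>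
          exp (- lam n * sum a ?S) * (\<Prod>i\<in>?S. 1 - exp (- (\<bar>lam i - lam n\<bar> * a i)))"
      proof (intro mult_mono \<kappa>(2))
        have "sum a ?S \<le> e"
          unfolding a_suminf[symmetric] using a by (intro sum_le_suminf a_summable) auto
        then show "exp (- (e * lam n)) \<le> exp (- lam n * sum a ?S)"
          using lam_pos[of n] by (simp add: mult.commute[of e])
      qed (use \<kappa>(1) in auto)
      ultimately have "exp (- (e * lam n)) * (\<kappa> * exp (- (e * lam n))) \<le> \<bar>P n k (lam n)\<bar>"
        by linarith
      moreover have "exp (- (e * lam n)) * (e\<^sup>2 / 8) \<le> \<bar>I (lam n)\<bar>"
        using tent_laplace_lower_bound[OF e, of "lam n"] lam_pos[of n] unfolding I_def h_def by simp
      ultimately have "(exp (- (e * lam n)) * (\<kappa> * exp (- (e * lam n)))) * (exp (- (e * lam n)) * (e\<^sup>2 / 8))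
          \<le> \<bar>P n k (lam n)\<bar> * \<bar>I (lam n)\<bar>"
        by (intro mult_mono) auto
      moreover have "exp (- (3 * e * lam n)) =
          exp (- (e * lam n)) * exp (- (e * lam n)) * exp (- (e * lam n))"
        by (simp flip: exp_add)
      ultimately show ?thesis
        by (simp add: abs_mult mult_ac)
    qed
    moreover have "(\<lambda>k. \<bar>P n k (lam n) * I (lam n)\<bar>) \<longlonglongrightarrow> \<bar>J n n\<bar>"
      unfolding J_def by (intro tendsto_rabs G(4))
    ultimately show ?thesis
      by (intro LIMSEQ_le_const) auto
  qed
  define b where "b = \<kappa> * (e\<^sup>2 / 8)"
  have b: "b > 0" using \<kappa>(1) e by (simp add: b_def)
  have J_pos: "0 < b * exp (- (3 * e * lam n))" "b * exp (- (3 * e * lam n)) \<le> \<bar>J n n\<bar>" for n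
    using J_diag[of n] b by (simp_all add: b_def)
  have W: "W \<ge> 0" using e by (simp add: W_def)
  show ?thesis
  proof (rule that[of "\<lambda>n t. G n t / J n n" "W / b"])
    show "continuous_on UNIV (\<lambda>t. G n t / J n n)" for n
      using G(1)[of n] J_pos[of n] by (intro continuous_intros) auto
    show "G n t / J n n = 0" if "t \<notin> {0..\<epsilon>}" for n t
      using that assms G(3)[of t n] by (auto simp: e_def)
    show "\<bar>G n t / J n n\<bar> \<le> W / b * exp (\<epsilon> * lam n)" for n t
    proof -
      have "\<bar>G n t / J n n\<bar> \<le> W / (b * exp (- (3 * e * lam n)))"
        unfolding abs_divide using G(2) J_pos[of n] W by (intro frac_le) auto
      also have "\<dots> = W / b * exp (3 * e * lam n)"
        by (simp add: exp_minus field_simps)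
      also have "\<dots> \<le> W / b * exp (\<epsilon> * lam n)"
        using W b assms lam_pos[of n] by (intro mult_left_mono) (auto simp: e_def)
      finally show ?thesis .
    qed
    show "(LINT t|lborel. exp (- lam m * t) * (G n t / J n n)) = (if m = n then 1 else 0)" for m n
    proof -
      have "(LINT t|lborel. exp (- lam m * t) * (G n t / J n n)) = J n m / J n n"
        unfolding J_def by (simp flip: times_divide_eq_right Bochner_Integration.integral_divide_zero)
      then show ?thesis using J_off[of m n] J_pos[of n] by auto
    qed
  qed
qed

text \<open>The solution is the series of the \<open>c k * \<psi> k (t - x0)\<close>. Its terms grow
  by \<open>exp (\<epsilon> * lam k)\<close> and decay by \<open>exp (- \<eta> * lam k)\<close>; as
  \<open>\<epsilon> < \<eta>\<close> and \<open>lam k\<close> has order \<beta> > \<alpha>, the net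
  decay also beats \<open>exp (q * real (Suc k) powr \<alpha>)\<close>. The translation to
  \<open>x0\<close> accounts for the factor \<open>exp (- lam m * x0)\<close> in the
  moments.\<close>

lemma exponential_moment_problem:
  fixes c :: "nat \<Rightarrow> real" and x0 \<epsilon> \<eta> \<alpha> q R :: real
  assumes \<epsilon>: "\<epsilon> > 0" "\<epsilon> < \<eta>" and \<alpha>: "0 \<le> \<alpha>" "\<alpha> < \<beta>"
    and c: "\<And>k. \<bar>c k\<bar> \<le> R * exp (q * real (Suc k) powr \<alpha> - \<eta> * lam k)"
  obtains \<nu> where "continuous_on UNIV \<nu>" "\<And>t. t \<notin> {x0..x0 + \<epsilon>} \<Longrightarrow> \<nu> t = 0"
    "\<And>m. (LINT t|lborel. exp (- lam m * t) * \<nu> t) = exp (- lam m * x0) * c m"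
proof -
  obtain \<psi> :: "nat \<Rightarrow> real \<Rightarrow> real" and K where \<psi>: "\<And>n. continuous_on UNIV (\<psi> n)"
    "\<And>n t. t \<notin> {0..\<epsilon>} \<Longrightarrow> \<psi> n t = 0"
    "\<And>n t. \<bar>\<psi> n t\<bar> \<le> K * exp (\<epsilon> * lam n)"
    "\<And>m n. (LINT t|lborel. exp (- lam m * t) * \<psi> n t) = (if m = n then 1 else 0)"
    using biorthogonal_family[OF \<epsilon>(1)] by blast
  have R: "R \<ge> 0"
    using order_trans[OF abs_ge_zero c[of 0]] by (simp add: zero_le_mult_iff)
  define F where "F = (\<lambda>k t. c k * \<psi> k (t - x0))"
  define bd where "bd = (\<lambda>k. R * K * exp (q * real (Suc k) powr \<alpha> - (\<eta> - \<epsilon>) * lam k))"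
  have F_bd: "\<bar>F k t\<bar> \<le> bd k" for k t
  proof -
    have "\<bar>F k t\<bar> \<le> (R * exp (q * real (Suc k) powr \<alpha> - \<eta> * lam k)) * (K * exp (\<epsilon> * lam k))"
      unfolding F_def abs_mult using R by (intro mult_mono c \<psi>(3)) auto
    also have "\<dots> = bd k"
    proof -
      have "exp (q * real (Suc k) powr \<alpha> - (\<eta> - \<epsilon>) * lam k) =
          exp (q * real (Suc k) powr \<alpha> - \<eta> * lam k) * exp (\<epsilon> * lam k)"
        by (simp add: algebra_simps flip: exp_add)
      then show ?thesis by (simp only: bd_def mult_ac)
    qed
    finally show ?thesis .
  qed
  have bd_summable: "summable bd"
  proof -
    have ev: "\<forall>\<^sub>F k in sequentially.
        exp (q * real (Suc k) powr \<alpha> - (\<eta> - \<epsilon>) * m0 * real (Suc k) powr \<beta>) \<le> 1 / real (Suc k) ^ 2"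
    proof -
      define \<delta> where "\<delta> = (\<eta> - \<epsilon>) * m0"
      have "\<delta> > 0" using \<epsilon> m0 by (simp add: \<delta>_def)
      then have "\<forall>\<^sub>F k in sequentially.
        exp (q * real (Suc k) powr \<alpha> - \<delta> * real (Suc k) powr \<beta>) \<le> 1 / real (Suc k) ^ 2"
        using \<alpha> by real_asymp
      then show ?thesis by (simp only: \<delta>_def)
    qed
    have "summable (\<lambda>k. exp (q * real (Suc k) powr \<alpha> - (\<eta> - \<epsilon>) * lam k))"
    proof (rule summable_comparison_test_ev[OF _ summable_inverse_Suc_square])
      show "\<forall>\<^sub>F k in sequentially. norm (exp (q * real (Suc k) powr \<alpha> - (\<eta> - \<epsilon>) * lam k)) \<le> 1 / real (Suc k) ^ 2"
        using ev
      proof eventually_elim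
        case (elim k)
        have "(\<eta> - \<epsilon>) * (m0 * real (Suc k) powr \<beta>) \<le> (\<eta> - \<epsilon>) * lam k"
          using \<epsilon> lower[of k] by (intro mult_left_mono) auto
        then have "exp (q * real (Suc k) powr \<alpha> - (\<eta> - \<epsilon>) * lam k) \<le>
            exp (q * real (Suc k) powr \<alpha> - (\<eta> - \<epsilon>) * m0 * real (Suc k) powr \<beta>)"
          by (simp add: mult.assoc)
        then show ?case
          using elim unfolding real_norm_def abs_exp_cancel by (rule order_trans)
      qed
    qed
    then show ?thesis unfolding bd_def by (rule summable_mult)
  qed
  define \<nu> where "\<nu> = (\<lambda>t. \<Sum>k. F k t)"
  have F_cont: "continuous_on UNIV (F k)" for k
    unfolding F_def by (intro continuous_intros continuous_on_compose2[OF \<psi>(1)]) auto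
  have F_supp: "F k t = 0" if "t \<notin> {x0..x0 + \<epsilon>}" for k t
    using that \<psi>(2)[of "t - x0" k] by (auto simp: F_def)
  have \<nu>_cont: "continuous_on UNIV \<nu>"
  proof (rule uniform_limit_theorem)
    show "\<forall>\<^sub>F n in sequentially. continuous_on UNIV (\<lambda>t. \<Sum>k<n. F k t)"
      using F_cont by (intro always_eventually allI continuous_on_sum) auto
    show "uniform_limit UNIV (\<lambda>n t. \<Sum>k<n. F k t) \<nu> sequentially"
      unfolding \<nu>_def using F_bd by (intro Weierstrass_m_test[OF _ bd_summable]) auto
  qed simp
  have \<nu>_supp: "\<nu> t = 0" if "t \<notin> {x0..x0 + \<epsilon>}" for t
    using F_supp[OF that] by (simp add: \<nu>_def)
  have "(LINT t|lborel. exp (- lam m * t) * \<nu> t) = exp (- lam m * x0) * c m" for m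
  proof -
    let ?f = "\<lambda>k t. exp (- lam m * t) * F k t"
    have int: "integrable lborel (?f k)" for k
      by (rule integrable_lborel_compact_support[OF F_cont _ F_supp]) (auto intro!: continuous_intros)
    \<comment> \<open>All \<open>F k\<close> vanish outside one interval, so
      \<open>bd k * g t\<close> dominates the terms and summability of \<open>bd\<close> justifies
      exchanging sum and integral.\<close>
    define g where "g = (\<lambda>t. indicator {x0..x0 + \<epsilon>} t *\<^sub>R exp (- lam m * t))"
    have g: "integrable lborel g"
      unfolding g_def by (intro borel_integrable_compact continuous_intros) auto
    have "(LINT t|lborel. norm (?f k t)) \<le> bd k * (LINT t|lborel. g t)" for k
    proof -
      have "(LINT t|lborel. norm (?f k t)) \<le> (LINT t|lborel. bd k * g t)"
      proof (rule integral_mono)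
        show "integrable lborel (\<lambda>t. norm (?f k t))" using int by (rule integrable_norm)
        show "integrable lborel (\<lambda>t. bd k * g t)" using g by simp
        show "norm (?f k t) \<le> bd k * g t" for t
          using F_bd[of k t] F_supp[of t k] by (cases "t \<in> {x0..x0 + \<epsilon>}") (auto simp: g_def abs_mult)
      qed
      then show ?thesis by simp
    qed
    then have "summable (\<lambda>k. LINT t|lborel. norm (?f k t))"
      by (intro summable_comparison_test'[OF summable_mult2[OF bd_summable], of 0]) simp
    moreover have "summable (\<lambda>k. norm (?f k t))" for t
    proof (rule summable_comparison_test'[OF summable_mult[OF bd_summable, of "exp (- lam m * t)"], of 0])
      show "norm (norm (?f k t)) \<le> exp (- lam m * t) * bd k" for k
        using F_bd[of k t] by (simp add: abs_mult)
    qed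
    ultimately have "(LINT t|lborel. (\<Sum>k. ?f k t)) = (\<Sum>k. LINT t|lborel. ?f k t)"
      using int by (intro integral_suminf) auto
    moreover have "(\<Sum>k. ?f k t) = exp (- lam m * t) * \<nu> t" for t
    proof -
      have "summable (\<lambda>k. F k t)"
        using F_bd by (intro summable_comparison_test'[OF bd_summable, of 0]) auto
      then show ?thesis by (simp add: \<nu>_def suminf_mult)
    qed
    moreover have "(LINT t|lborel. ?f k t) = (if k = m then exp (- lam m * x0) * c k else 0)" for k
    proof -
      have "(LINT t|lborel. ?f k t) = (LINT t|lborel. c k * (exp (- lam m * t) * \<psi> k (t - x0)))"
        by (intro Bochner_Integration.integral_cong) (simp_all add: F_def)
      also have "\<dots> = c k * (exp (- lam m * x0) * (if m = k then 1 else 0))"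
        by (simp only: Bochner_Integration.integral_mult_right_zero lborel_integral_laplace_shift \<psi>(4))
      finally show ?thesis by simp
    qed
    ultimately show ?thesis
      using sums_unique[OF sums_single[of m "\<lambda>k. exp (- lam m * x0) * c k"]] by simp
  qed
  then show ?thesis using that \<nu>_cont \<nu>_supp by blast
qed

end

text \<open>The ratio \<open>X\<close> is positive throughout and tends to \<open>M > 0\<close>, so
  both \<open>X\<close> and its inverse are bounded sequences. Positivity takes care of the small
  indices, about which the asymptotics say nothing.\<close>

lemma powr_asymptotic_bounds:
  fixes \<mu> :: "nat \<Rightarrow> real"
  assumes "M > 0" "\<sigma> > 0" and pos: "\<And>n. n \<ge> 1 \<Longrightarrow> \<mu> n > 0"
    and asymp: "(\<lambda>n. \<mu> n / (M * real n powr \<beta>) - 1) \<in> o(\<lambda>n. real n powr (- \<sigma>))"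
  obtains m0 m1 where "m0 > 0" "\<And>n. m0 * real (Suc n) powr \<beta> \<le> \<mu> (Suc n)"
    "\<And>n. \<mu> (Suc n) \<le> m1 * real (Suc n) powr \<beta>"
proof -
  define X where "X = (\<lambda>n. \<mu> (Suc n) / real (Suc n) powr \<beta>)"
  have "(\<lambda>n. real n powr (- \<sigma>)) \<in> O(\<lambda>_. 1)"
    using \<open>\<sigma> > 0\<close> by real_asymp
  with asymp have "(\<lambda>n. \<mu> n / (M * real n powr \<beta>) - 1) \<in> o(\<lambda>_. 1)"
    by (rule landau_o.small_big_trans)
  then have "(\<lambda>n. \<mu> n / (M * real n powr \<beta>) - 1) \<longlonglongrightarrow> 0"
    using smalloD_tendsto by fastforce
  then have "(\<lambda>n. M * (\<mu> (Suc n) / (M * real (Suc n) powr \<beta>) - 1 + 1)) \<longlonglongrightarrow> M * (0 + 1)"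
    by (intro tendsto_intros LIMSEQ_Suc)
  then have lim: "X \<longlonglongrightarrow> M"
    using \<open>M > 0\<close> by (simp add: X_def)
  have X_pos: "X n > 0" for n
    using pos[of "Suc n"] by (simp add: X_def)
  have "Bseq X"
    using convergent_imp_Bseq[OF convergentI[OF lim]] .
  then obtain m1 where m1: "m1 > 0" "\<forall>n. norm (X n) \<le> m1"
    by (rule BseqE)
  have "(\<lambda>n. inverse (X n)) \<longlonglongrightarrow> inverse M"
    using lim \<open>M > 0\<close> by (intro tendsto_inverse) auto
  then have "Bseq (\<lambda>n. inverse (X n))"
    by (rule convergent_imp_Bseq[OF convergentI])
  then obtain m where m: "m > 0" "\<forall>n. norm (inverse (X n)) \<le> m"
    by (rule BseqE)
  show ?thesis
  proof (rule that[of "1 / m" m1])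
    show "1 / m > 0" using m by simp
    show "1 / m * real (Suc n) powr \<beta> \<le> \<mu> (Suc n)" for n
    proof -
      have "1 / m \<le> X n"
        using m(1) spec[OF m(2), of n] X_pos[of n] by (simp add: field_simps)
      then have "1 / m * real (Suc n) powr \<beta> \<le> X n * real (Suc n) powr \<beta>"
        by (rule mult_right_mono) simp
      then show ?thesis by (simp add: X_def)
    qed
    show "\<mu> (Suc n) \<le> m1 * real (Suc n) powr \<beta>" for n
    proof -
      have "X n * real (Suc n) powr \<beta> \<le> m1 * real (Suc n) powr \<beta>"
        using spec[OF m1(2), of n] by (intro mult_right_mono) auto
      then show ?thesis by (simp add: X_def)
    qed
  qed
qed

subsection \<open>Integrals over compact sets and square-integrable functions\<close>

lemma continuous_on_slices:
  fixes H :: "'a::topological_space \<Rightarrow> 'b::topological_space \<Rightarrow> 'c::topological_space"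
  assumes "continuous_on (S \<times> T) (\<lambda>(x, t). H x t)"
  shows "x \<in> S \<Longrightarrow> continuous_on T (H x)" and "t \<in> T \<Longrightarrow> continuous_on S (\<lambda>x. H x t)"
proof -
  assume "x \<in> S"
  then show "continuous_on T (H x)"
    using continuous_on_compose2[OF assms, of T "\<lambda>t. (x, t)"]
      continuous_on_Pair[OF continuous_on_const[of T x] continuous_on_id]
    by (simp add: image_subset_iff)
next
  assume "t \<in> T"
  then show "continuous_on S (\<lambda>x. H x t)"
    using continuous_on_compose2[OF assms, of S "\<lambda>x. (x, t)"]
      continuous_on_Pair[OF continuous_on_id continuous_on_const[of S t]]
    by (simp add: image_subset_iff)
qed

lemma integrable_lebesgue_on_compact:
  fixes f :: "'a::euclidean_space \<Rightarrow> real"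
  assumes "compact S" "continuous_on S f"
  shows "integrable (lebesgue_on S) f"
    and "integral\<^sup>L (lebesgue_on S) f = (LINT x|lborel. indicator S x *\<^sub>R f x)"
proof -
  have S: "S \<inter> space lebesgue \<in> sets lebesgue"
    using assms(1) by (simp add: lmeasurable_compact fmeasurableD)
  have i: "integrable lborel (\<lambda>x. indicator S x *\<^sub>R f x)"
    by (rule borel_integrable_compact[OF assms])
  then have m: "(\<lambda>x. indicator S x *\<^sub>R f x) \<in> borel_measurable lborel"
    by (rule borel_measurable_integrable)
  have "integrable lebesgue (\<lambda>x. indicator S x *\<^sub>R f x)"
    using i by (simp only: integrable_completion[OF m])
  then show "integrable (lebesgue_on S) f"
    by (simp add: integrable_restrict_space[OF S])
  show "integral\<^sup>L (lebesgue_on S) f = (LINT x|lborel. indicator S x *\<^sub>R f x)"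
    by (simp only: integral_restrict_space[OF S] integral_completion[OF m])
qed

text \<open>Extended by zero, the integrand is Borel and integrable on the whole product space,
  where Fubini applies to \<open>lborel\<close>. Completion and restriction of the measures do not
  change the integrals.\<close>

lemma lebesgue_on_Fubini_compact:
  fixes H :: "'a::euclidean_space \<Rightarrow> 'b::euclidean_space \<Rightarrow> real"
  assumes S: "compact S" and T: "compact T" and H: "continuous_on (S \<times> T) (\<lambda>(x, t). H x t)"
  shows "(LINT x|lebesgue_on S. LINT t|lebesgue_on T. H x t) =
    (LINT t|lebesgue_on T. LINT x|lebesgue_on S. H x t)"
proof -
  define F where "F = (\<lambda>x t. indicator (S \<times> T) (x, t) *\<^sub>R H x t)"
  have "integrable lborel (\<lambda>p. indicator (S \<times> T) p *\<^sub>R (case p of (x, t) \<Rightarrow> H x t))"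
    by (intro borel_integrable_compact compact_Times S T H)
  then have F: "integrable (lborel \<Otimes>\<^sub>M lborel) (case_prod F)"
    by (simp add: F_def lborel_prod case_prod_unfold)
  note Hx = continuous_on_slices(1)[OF H] and Ht = continuous_on_slices(2)[OF H]
  have S': "S \<inter> space lebesgue \<in> sets lebesgue" and T': "T \<inter> space lebesgue \<in> sets lebesgue"
    using S T by (simp_all add: lmeasurable_compact fmeasurableD)
  have x_int: "indicator S x *\<^sub>R (LINT t|lebesgue_on T. H x t) = (LINT t|lborel. F x t)" for x
    by (cases "x \<in> S")
      (simp_all add: integrable_lebesgue_on_compact(2)[OF T Hx] F_def indicator_times)
  have t_int: "indicator T t *\<^sub>R (LINT x|lebesgue_on S. H x t) = (LINT x|lborel. F x t)" for t
    by (cases "t \<in> T")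
      (simp_all add: integrable_lebesgue_on_compact(2)[OF S Ht] F_def indicator_times)
  have Fx: "(\<lambda>x. LINT t|lborel. F x t) \<in> borel_measurable lborel"
    using lborel_pair.integrable_fst[OF F] by (rule borel_measurable_integrable)
  have Ft: "(\<lambda>t. LINT x|lborel. F x t) \<in> borel_measurable lborel"
    using lborel_pair.integrable_snd[OF F] by (rule borel_measurable_integrable)
  have "(LINT x|lebesgue_on S. LINT t|lebesgue_on T. H x t) = (LINT x|lborel. LINT t|lborel. F x t)"
    by (simp only: integral_restrict_space[OF S'] x_int integral_completion[OF Fx])
  also have "\<dots> = (LINT t|lborel. LINT x|lborel. F x t)"
    by (rule lborel_pair.Fubini_integral[OF F, symmetric])
  also have "\<dots> = (LINT t|lebesgue_on T. LINT x|lebesgue_on S. H x t)"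
    by (simp only: integral_restrict_space[OF T'] t_int integral_completion[OF Ft])
  finally show ?thesis .
qed

text \<open>Serves to make the controlled time averages continuous in \<open>x\<close>, so that an
  identity almost everywhere extends to all points.\<close>

lemma continuous_on_lebesgue_integral_param:
  fixes H :: "'a::euclidean_space \<Rightarrow> real \<Rightarrow> real"
  assumes H: "continuous_on (S \<times> {a..b}) (\<lambda>(x, t). H x t)"
  shows "continuous_on S (\<lambda>x. LINT t|lebesgue_on {a..b}. H x t)"
proof -
  have "(LINT t|lebesgue_on {a..b}. H x t) = integral (cbox a b) (H x)" if "x \<in> S" for x
  proof -
    have "continuous_on {a..b} (H x)"
      by (rule continuous_on_slices(1)[OF H that])
    then show ?thesis
      by (simp add: lebesgue_integral_eq_integral integrable_lebesgue_on_compact(1) fmeasurableD)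
  qed
  then show ?thesis
    using integral_continuous_on_param[of S a b H] H by (simp cong: continuous_on_cong)
qed

section \<open>Inner products, convergence and orthonormal expansions in \<open>L2\<close>\<close>

lemma L2_continuous_on_compact:
  assumes "compact S" "continuous_on S f"
  shows "f \<in> L2 S"
  using assms
  by (auto simp: L2_def lmeasurable_compact fmeasurableD
      intro!: continuous_imp_measurable_on_sets_lebesgue integrable_lebesgue_on_compact(1) continuous_intros)

lemma L2_times_integrable:
  assumes "f \<in> L2 S" "g \<in> L2 S"
  shows "integrable (lebesgue_on S) (\<lambda>x. f x * g x)"
proof (rule Bochner_Integration.integrable_bound)
  show "integrable (lebesgue_on S) (\<lambda>x. (f x)\<^sup>2 + (g x)\<^sup>2)"
    using assms by (simp add: L2_def)
  show "(\<lambda>x. f x * g x) \<in> borel_measurable (lebesgue_on S)"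
    using assms by (auto simp: L2_def)
  have "norm (f x * g x) \<le> norm ((f x)\<^sup>2 + (g x)\<^sup>2)" for x
  proof -
    have "2 * (\<bar>f x\<bar> * \<bar>g x\<bar>) \<le> \<bar>f x\<bar>\<^sup>2 + \<bar>g x\<bar>\<^sup>2"
      using sum_squares_bound[of "\<bar>f x\<bar>" "\<bar>g x\<bar>"] by (simp add: mult.assoc)
    moreover have "0 \<le> \<bar>f x\<bar> * \<bar>g x\<bar>" by simp
    moreover have "norm ((f x)\<^sup>2 + (g x)\<^sup>2) = \<bar>f x\<bar>\<^sup>2 + \<bar>g x\<bar>\<^sup>2" by simp
    ultimately show ?thesis unfolding real_norm_def abs_mult by linarith
  qed
  then show "AE x in lebesgue_on S. norm (f x * g x) \<le> norm ((f x)\<^sup>2 + (g x)\<^sup>2)" by simp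
qed

lemma L2_scale:
  assumes "f \<in> L2 S"
  shows "(\<lambda>x. c * f x) \<in> L2 S"
  using assms by (auto simp: L2_def power_mult_distrib)

lemma L2_add:
  assumes "f \<in> L2 S" "g \<in> L2 S"
  shows "(\<lambda>x. f x + g x) \<in> L2 S"
proof -
  have "integrable (lebesgue_on S) (\<lambda>x. (f x)\<^sup>2 + (g x)\<^sup>2 + 2 * (f x * g x))"
    using assms L2_times_integrable[OF assms] by (simp add: L2_def)
  then show ?thesis
    using assms by (auto simp: L2_def power2_sum mult.assoc)
qed

lemma L2_diff:
  assumes "f \<in> L2 S" "g \<in> L2 S"
  shows "(\<lambda>x. f x - g x) \<in> L2 S"
  using L2_add[OF assms(1) L2_scale[OF assms(2), of "-1"]] by simp

lemma L2_zero: "(\<lambda>x. 0) \<in> L2 S"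
  by (simp add: L2_def)

lemma L2_sum:
  assumes "\<And>i. i \<in> I \<Longrightarrow> f i \<in> L2 S"
  shows "(\<lambda>x. \<Sum>i\<in>I. f i x) \<in> L2 S"
  using assms by (induction I rule: infinite_finite_induct) (auto intro: L2_add L2_zero)

lemma L2_inner_commute: "L2_inner S f g = L2_inner S g f"
  by (simp add: L2_inner_def mult.commute)

lemma L2_inner_scale_left: "L2_inner S (\<lambda>x. c * f x) g = c * L2_inner S f g"
  by (simp add: L2_inner_def mult.assoc)

lemma L2_inner_diff_left:
  assumes "f \<in> L2 S" "g \<in> L2 S" "h \<in> L2 S"
  shows "L2_inner S (\<lambda>x. f x - g x) h = L2_inner S f h - L2_inner S g h"
  using L2_times_integrable[OF assms(1,3)] L2_times_integrable[OF assms(2,3)]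
  by (simp add: L2_inner_def left_diff_distrib)

lemma L2_inner_sum_left:
  assumes "\<And>i. i \<in> I \<Longrightarrow> f i \<in> L2 S" "h \<in> L2 S"
  shows "L2_inner S (\<lambda>x. \<Sum>i\<in>I. f i x) h = (\<Sum>i\<in>I. L2_inner S (f i) h)"
  using L2_times_integrable[OF assms]
  by (simp add: L2_inner_def sum_distrib_right Bochner_Integration.integral_sum)

lemma L2_inner_self_nonneg: "L2_inner S f f \<ge> 0"
  by (simp add: L2_inner_def)

lemma L2_Cauchy_Schwarz:
  assumes f: "f \<in> L2 S" and g: "g \<in> L2 S"
  shows "\<bar>L2_inner S f g\<bar> \<le> L2_norm S f * L2_norm S g"
proof -
  let ?a = "L2_inner S f f" and ?b = "L2_inner S f g" and ?c = "L2_inner S g g"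
  have quad: "0 \<le> ?a - 2 * t * ?b + t\<^sup>2 * ?c" for t
  proof -
    have tg: "(\<lambda>x. t * g x) \<in> L2 S" by (rule L2_scale[OF g])
    have d: "(\<lambda>x. f x - t * g x) \<in> L2 S" by (rule L2_diff[OF f tg])
    have "L2_inner S (\<lambda>x. f x - t * g x) (\<lambda>x. f x - t * g x) =
        L2_inner S (\<lambda>x. f x - t * g x) f - t * L2_inner S (\<lambda>x. f x - t * g x) g"
      using L2_inner_diff_left[OF f tg d] L2_inner_scale_left[of S t g]
      by (simp add: L2_inner_commute[of S f] L2_inner_commute[of S g])
    also have "\<dots> = ?a - 2 * t * ?b + t\<^sup>2 * ?c"
      unfolding L2_inner_diff_left[OF f tg f] L2_inner_diff_left[OF f tg g] L2_inner_scale_left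
      by (simp add: L2_inner_commute[of S g f] power2_eq_square algebra_simps)
    finally show ?thesis using L2_inner_self_nonneg[of S] by metis
  qed
  have "?b\<^sup>2 \<le> ?a * ?c"
  proof (cases "?c = 0")
    case True
    have "?b = 0"
    proof (rule ccontr)
      assume "?b \<noteq> 0"
      \<comment> \<open>At this \<open>t\<close> the quadratic, here linear in \<open>t\<close>, has
        the value -1.\<close>
      then show False using quad[of "(?a + 1) / (2 * ?b)"] True by simp
    qed
    then show ?thesis using True by simp
  next
    case False
    then have "?c > 0" using L2_inner_self_nonneg[of S g] by linarith
    then show ?thesis
      using quad[of "?b / ?c"] by (simp add: field_simps power2_eq_square)
  qed
  then have "sqrt (?b\<^sup>2) \<le> sqrt (?a * ?c)" by (rule real_sqrt_le_mono)
  then show ?thesis by (simp add: L2_norm_def real_sqrt_mult)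
qed

text \<open>The filter is left open because the limit is taken both along partial sums and as time
  tends to 0 from the right.\<close>

lemma L2_inner_tendsto:
  assumes conv: "((\<lambda>k. L2_norm S (\<lambda>x. u k x - v x)) \<longlongrightarrow> 0) F"
    and u: "\<forall>\<^sub>F k in F. u k \<in> L2 S" and v: "v \<in> L2 S" and h: "h \<in> L2 S"
  shows "((\<lambda>k. L2_inner S (u k) h) \<longlongrightarrow> L2_inner S v h) F"
proof -
  have "((\<lambda>k. L2_inner S (u k) h - L2_inner S v h) \<longlongrightarrow> 0) F"
  proof (rule Lim_null_comparison)
    show "\<forall>\<^sub>F k in F. norm (L2_inner S (u k) h - L2_inner S v h) \<le>
        L2_norm S (\<lambda>x. u k x - v x) * L2_norm S h"
      using u
    proof eventually_elim
      case (elim k)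
      then show ?case
        using L2_Cauchy_Schwarz[OF L2_diff[OF elim v] h] L2_inner_diff_left[OF elim v h] by simp
    qed
    show "((\<lambda>k. L2_norm S (\<lambda>x. u k x - v x) * L2_norm S h) \<longlongrightarrow> 0) F"
      using tendsto_mult_right[OF conv, of "L2_norm S h"] by simp
  qed
  then show ?thesis by (simp add: Lim_null[symmetric])
qed

text \<open>The interior points with \<open>W \<noteq> 0\<close> form an open null set, which must
  be empty; every other point of \<open>S\<close> is a limit of interior points.\<close>

lemma continuous_on_AE_zero_closure_interior:
  fixes W :: "'a::euclidean_space \<Rightarrow> real"
  assumes closure: "closure (interior S) = S" and cont: "continuous_on S W"
    and AE: "AE x in lebesgue_on S. W x = 0" and "x \<in> S"
  shows "W x = 0"
proof -
  have S: "S \<in> sets lebesgue"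
    using closure closed_closure[of "interior S"] by auto
  have int: "W y = 0" if y: "y \<in> interior S" for y
  proof (rule ccontr)
    assume "W y \<noteq> 0"
    define U where "U = {x \<in> interior S. W x \<noteq> 0}"
    have "continuous_on (interior S) W"
      using cont interior_subset by (rule continuous_on_subset)
    then have "open (interior S \<inter> W -` (- {0}))"
      by (intro continuous_open_preimage) auto
    then have "open U" by (simp add: U_def vimage_def Int_def)
    moreover have "AE x in lebesgue. x \<in> S \<longrightarrow> W x = 0"
      using AE S by (simp add: AE_restrict_space_iff)
    then have "AE x in lebesgue. x \<notin> U"
      by eventually_elim (use interior_subset[of S] in \<open>auto simp: U_def\<close>)
    then have "negligible U"
      using \<open>open U\<close> by (simp add: negligible_iff_null_sets AE_iff_null_sets[symmetric] lebesgue_openin)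
    moreover have "U \<noteq> {}" using y \<open>W y \<noteq> 0\<close> by (auto simp: U_def)
    ultimately show False using open_not_negligible by blast
  qed
  show ?thesis
    by (rule continuous_constant_on_closure[of "interior S" W 0 x])
      (use cont closure int \<open>x \<in> S\<close> in auto)
qed

lemma lebesgue_on_support:
  fixes f :: "'a::euclidean_space \<Rightarrow> real"
  assumes "S \<in> sets lebesgue" "T \<in> sets lebesgue" "S \<subseteq> T" "\<And>t. t \<in> T - S \<Longrightarrow> f t = 0"
  shows "integrable (lebesgue_on T) f \<longleftrightarrow> integrable (lebesgue_on S) f"
    and "integral\<^sup>L (lebesgue_on T) f = integral\<^sup>L (lebesgue_on S) f"
proof -
  have eq: "(\<lambda>x. indicator T x *\<^sub>R f x) = (\<lambda>x. indicator S x *\<^sub>R f x)"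
    using assms(3,4) by (auto simp: indicator_def fun_eq_iff)
  have S: "S \<inter> space lebesgue \<in> sets lebesgue" and T: "T \<inter> space lebesgue \<in> sets lebesgue"
    using assms(1,2) by simp_all
  show "integrable (lebesgue_on T) f \<longleftrightarrow> integrable (lebesgue_on S) f"
    by (simp only: integrable_restrict_space[OF S] integrable_restrict_space[OF T] eq)
  show "integral\<^sup>L (lebesgue_on T) f = integral\<^sup>L (lebesgue_on S) f"
    by (simp only: integral_restrict_space[OF S] integral_restrict_space[OF T] eq)
qed

lemma L2_inner_time_average:
  fixes S :: "'a::euclidean_space set" and a b :: real
  assumes S: "compact S" and h: "continuous_on S h"
    and v: "continuous_on (S \<times> {a..b}) (\<lambda>(x, t). v x t)" and \<nu>: "continuous_on {a..b} \<nu>"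
  shows "L2_inner S (\<lambda>x. LINT t|lebesgue_on {a..b}. v x t * \<nu> t) h =
    (LINT t|lebesgue_on {a..b}. L2_inner S (\<lambda>x. v x t) h * \<nu> t)"
proof -
  have "continuous_on (S \<times> {a..b}) (\<lambda>z. (case z of (x, t) \<Rightarrow> v x t) * \<nu> (snd z) * h (fst z))"
    by (intro continuous_intros v continuous_on_compose2[OF h] continuous_on_compose2[OF \<nu>]) auto
  then have cont: "continuous_on (S \<times> {a..b}) (\<lambda>(x, t). v x t * \<nu> t * h x)"
    by (simp add: case_prod_unfold)
  have "L2_inner S (\<lambda>x. LINT t|lebesgue_on {a..b}. v x t * \<nu> t) h =
      (LINT x|lebesgue_on S. LINT t|lebesgue_on {a..b}. v x t * \<nu> t * h x)"
    by (simp add: L2_inner_def)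
  also have "\<dots> = (LINT t|lebesgue_on {a..b}. LINT x|lebesgue_on S. v x t * \<nu> t * h x)"
    by (rule lebesgue_on_Fubini_compact[OF S compact_Icc cont])
  also have "\<dots> = (LINT t|lebesgue_on {a..b}. L2_inner S (\<lambda>x. v x t) h * \<nu> t)"
    unfolding L2_inner_def integral_mult_left_zero[symmetric] by (simp only: mult_ac)
  finally show ?thesis .
qed

lemma L2_norm_diff_commute: "L2_norm S (\<lambda>x. f x - g x) = L2_norm S (\<lambda>x. g x - f x)"
proof -
  have "(f x - g x) * (f x - g x) = (g x - f x) * (g x - f x)" for x
    by (simp add: algebra_simps)
  then show ?thesis by (simp only: L2_norm_def L2_inner_def)
qed

text \<open>The inner product of a partial sum with \<open>\<phi> n l\<close> no longer changes once
  the sum includes the index \<open>n\<close>.\<close>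

lemma L2_orthonormal_expansion_coefficient:
  fixes d :: "nat \<Rightarrow> nat"
  assumes basis: "L2_orthonormal_basis S (SIGMA n:{1::nat..}. {..<d n}) (\<lambda>(n, l). \<phi> n l)"
    and g: "g \<in> L2 S"
    and conv: "(\<lambda>K. L2_norm S (\<lambda>x. g x - (\<Sum>n=1..K. \<Sum>l<d n. b n l * \<phi> n l x))) \<longlonglongrightarrow> 0"
    and n: "n \<ge> 1" "l < d n"
  shows "L2_inner S g (\<phi> n l) = b n l"
proof -
  have \<phi>: "\<phi> n l \<in> L2 S" if "n \<ge> 1" "l < d n" for n l
    using basis that by (force simp: L2_orthonormal_basis_def)
  have orth: "L2_inner S (\<phi> n' l') (\<phi> n l) = (if n' = n \<and> l' = l then 1 else 0)"
    if "n' \<ge> 1" "l' < d n'" for n' l'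
    using basis that n unfolding L2_orthonormal_basis_def by force
  let ?P = "\<lambda>K x. \<Sum>n=1..K. \<Sum>l<d n. b n l * \<phi> n l x"
  have "?P K \<in> L2 S" for K
    by (intro L2_sum L2_scale \<phi>) auto
  then have "(\<lambda>K. L2_inner S (?P K) (\<phi> n l)) \<longlonglongrightarrow> L2_inner S g (\<phi> n l)"
    using conv by (intro L2_inner_tendsto[OF _ _ g \<phi>[OF n]]) (simp_all add: L2_norm_diff_commute[of S _ g])
  moreover have "L2_inner S (?P K) (\<phi> n l) = b n l" if "K \<ge> n" for K
  proof -
    have "L2_inner S (?P K) (\<phi> n l) = (\<Sum>n'=1..K. L2_inner S (\<lambda>x. \<Sum>l'<d n'. b n' l' * \<phi> n' l' x) (\<phi> n l))"
      by (intro L2_inner_sum_left L2_sum L2_scale \<phi> n) auto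
    also have "\<dots> = (\<Sum>n'=1..K. \<Sum>l'<d n'. L2_inner S (\<lambda>x. b n' l' * \<phi> n' l' x) (\<phi> n l))"
      by (intro sum.cong refl L2_inner_sum_left L2_scale \<phi> n) auto
    also have "\<dots> = (\<Sum>n'=1..K. \<Sum>l'<d n'. if n' = n then (if l' = l then b n l else 0) else 0)"
      by (intro sum.cong refl) (auto simp: L2_inner_scale_left orth)
    also have "\<dots> = (\<Sum>n'=1..K. if n' = n then b n l else 0)"
      using n by (intro sum.cong refl) auto
    also have "\<dots> = b n l" using that n by simp
    finally show ?thesis .
  qed
  then have "(\<lambda>K. L2_inner S (?P K) (\<phi> n l)) \<longlonglongrightarrow> b n l"
    by (intro tendsto_eventually eventually_sequentiallyI[of n])
  ultimately show ?thesis by (rule LIMSEQ_unique)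
qed

subsection \<open>Spectral coefficients of solutions\<close>

lemma dirichlet_domain_L2:
  assumes "compact \<Omega>" "v \<in> dirichlet_domain \<Omega> N"
  shows "v \<in> L2 \<Omega>"
  using assms by (intro L2_continuous_on_compact) (auto simp: dirichlet_domain_def Ck_closed_def)

lemma eigenfunction_L2:
  assumes "compact \<Omega>" "eigenfunction \<Omega> N p lam \<phi>"
  shows "\<phi> \<in> L2 \<Omega>"
  using assms by (auto simp: eigenfunction_def intro: dirichlet_domain_L2)

context
  fixes \<Omega> :: "(real^'d::finite) set" and N :: nat and p :: "('d \<Rightarrow> nat) \<Rightarrow> real^'d \<Rightarrow> real"
  assumes \<Omega>: "compact \<Omega>" and self_adjoint: "self_adjoint_op \<Omega> N p"
begin

text \<open>Self-adjointness equates the graph of the adjoint with that of the closure. The constant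
  sequence \<open>\<phi>\<close> puts the pair of \<open>\<phi>\<close> and
  \<open>lam * \<phi>\<close> into the closure, and membership in the adjoint is the claim. No
  integration by parts is involved.\<close>

lemma L2_inner_diff_op_eigenfunction:
  assumes \<phi>: "eigenfunction \<Omega> N p lam \<phi>" and v: "v \<in> dirichlet_domain \<Omega> N"
  shows "L2_inner \<Omega> (diff_op \<Omega> N p v) \<phi> = lam * L2_inner \<Omega> v \<phi>"
proof -
  have "L2_norm \<Omega> (\<lambda>x. diff_op \<Omega> N p \<phi> x - lam * \<phi> x) = 0"
  proof -
    have "L2_inner \<Omega> (\<lambda>x. diff_op \<Omega> N p \<phi> x - lam * \<phi> x) (\<lambda>x. diff_op \<Omega> N p \<phi> x - lam * \<phi> x) =
        integral\<^sup>L (lebesgue_on \<Omega>) (\<lambda>x. 0)"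
      unfolding L2_inner_def using \<phi>
      by (intro Bochner_Integration.integral_cong) (auto simp: eigenfunction_def)
    then show ?thesis by (simp add: L2_norm_def)
  qed
  moreover have "L2_norm \<Omega> (\<lambda>x. \<phi> x - \<phi> x) = 0"
    by (simp add: L2_norm_def L2_inner_def)
  ultimately have "\<exists>u. (\<forall>k::nat. u k \<in> dirichlet_domain \<Omega> N) \<and>
        (\<lambda>k. L2_norm \<Omega> (\<lambda>x. u k x - \<phi> x)) \<longlonglongrightarrow> 0 \<and>
        (\<lambda>k. L2_norm \<Omega> (\<lambda>x. diff_op \<Omega> N p (u k) x - lam * \<phi> x)) \<longlonglongrightarrow> 0"
    using \<phi> by (intro exI[of _ "\<lambda>_. \<phi>"]) (simp add: eigenfunction_def)
  then have "\<forall>u\<in>dirichlet_domain \<Omega> N.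
      L2_inner \<Omega> (diff_op \<Omega> N p u) \<phi> = L2_inner \<Omega> u (\<lambda>x. lam * \<phi> x)"
    using self_adjoint eigenfunction_L2[OF \<Omega> \<phi>] L2_scale[OF eigenfunction_L2[OF \<Omega> \<phi>]]
    unfolding self_adjoint_op_def by blast
  then show ?thesis
    using v by (simp add: L2_inner_commute[of \<Omega> v] L2_inner_scale_left)
qed

text \<open>The function \<open>t \<mapsto> exp (lam * t) * L2_inner \<Omega> (u t) \<phi>\<close> is constant. Its increments are
  computed with Fubini's theorem, which avoids differentiating under the integral.\<close>

lemma evolution_coefficient:
  assumes \<phi>: "eigenfunction \<Omega> N p lam \<phi>" and u: "evolution_solution \<Omega> N p g u"
    and g: "g \<in> L2 \<Omega>" and t: "t > 0"
  shows "L2_inner \<Omega> (\<lambda>x. u x t) \<phi> = exp (- lam * t) * L2_inner \<Omega> g \<phi>"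
proof -
  let ?L = "\<lambda>x t. diff_op \<Omega> N p (\<lambda>y. u y t) x"
  let ?U = "\<lambda>t. L2_inner \<Omega> (\<lambda>x. u x t) \<phi>"
  have dom: "(\<lambda>x. u x t) \<in> dirichlet_domain \<Omega> N" if "t > 0" for t
    using u that by (simp add: evolution_solution_def)
  note u_L2 = dirichlet_domain_L2[OF \<Omega> dom]
  have cont_u: "continuous_on (\<Omega> \<times> {0<..}) (\<lambda>(x, t). u x t)"
    and cont_L: "continuous_on (\<Omega> \<times> {0<..}) (\<lambda>(x, t). ?L x t)"
    using u by (simp_all add: evolution_solution_def)
  have \<phi>_L2: "\<phi> \<in> L2 \<Omega>" by (rule eigenfunction_L2[OF \<Omega> \<phi>])
  have cont_\<phi>: "continuous_on \<Omega> \<phi>"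
    using \<phi> by (simp add: eigenfunction_def dirichlet_domain_def Ck_closed_def)
  have L_L2: "(\<lambda>x. ?L x t) \<in> L2 \<Omega>" if "t > 0" for t
    using continuous_on_slices(2)[OF cont_L, of t] that by (intro L2_continuous_on_compact \<Omega>) auto
  have const: "exp (lam * t) * ?U t = exp (lam * r) * ?U r" if r: "0 < r" "r < t" for r
  proof -
    \<comment> \<open>\<open>H x s\<close> is the derivative at \<open>s\<close> of
      \<open>exp (lam * s) * u x s * \<phi> x\<close>. Its integral over time is an increment of
      this function; its integral over space vanishes by the eigenfunction relation for
      \<open>diff_op\<close>.\<close>
    define H where "H = (\<lambda>x t. exp (lam * t) * (lam * u x t - ?L x t) * \<phi> x)"
    have sub: "\<Omega> \<times> {r..t} \<subseteq> \<Omega> \<times> {0<..}" using r by auto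
    have cont_H: "continuous_on (\<Omega> \<times> {r..t}) (\<lambda>(x, t). H x t)"
    proof -
      have "continuous_on (\<Omega> \<times> {r..t}) (\<lambda>z. exp (lam * snd z) *
          (lam * (case z of (x, t) \<Rightarrow> u x t) - (case z of (x, t) \<Rightarrow> ?L x t)) * \<phi> (fst z))"
        by (intro continuous_intros continuous_on_subset[OF cont_u sub]
            continuous_on_subset[OF cont_L sub] continuous_on_compose2[OF cont_\<phi>]) auto
      then show ?thesis by (simp add: H_def case_prod_unfold)
    qed
    have "(LINT s|lebesgue_on {r..t}. H x s) = (exp (lam * t) * u x t - exp (lam * r) * u x r) * \<phi> x"
      if x: "x \<in> \<Omega>" for x
    proof -
      have "((\<lambda>s. exp (lam * s) * u x s * \<phi> x) has_vector_derivative H x s) (at s within {r..t})"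
        if "s \<in> {r..t}" for s
      proof -
        have "((\<lambda>s. u x s) has_real_derivative - ?L x s) (at s)"
          using u x that r by (simp add: evolution_solution_def)
        then have "((\<lambda>s. exp (lam * s) * u x s * \<phi> x) has_real_derivative H x s) (at s)"
          unfolding H_def by (auto intro!: derivative_eq_intros simp: algebra_simps)
        then show ?thesis
          by (simp add: has_real_derivative_iff_has_vector_derivative has_vector_derivative_at_within)
      qed
      then have "(H x has_integral (exp (lam * t) * u x t * \<phi> x - exp (lam * r) * u x r * \<phi> x)) {r..t}"
        using r by (intro fundamental_theorem_of_calculus) auto
      moreover have "integrable (lebesgue_on {r..t}) (H x)"
        by (intro integrable_lebesgue_on_compact(1) continuous_on_slices(1)[OF cont_H x] compact_Icc)
      ultimately show ?thesis
        by (simp add: lebesgue_integral_eq_integral fmeasurableD integral_unique left_diff_distrib)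
    qed
    then have "(LINT x|lebesgue_on \<Omega>. LINT s|lebesgue_on {r..t}. H x s) =
        L2_inner \<Omega> (\<lambda>x. exp (lam * t) * u x t - exp (lam * r) * u x r) \<phi>"
      unfolding L2_inner_def by (intro Bochner_Integration.integral_cong) auto
    also have "\<dots> = exp (lam * t) * ?U t - exp (lam * r) * ?U r"
      using r t by (simp add: L2_inner_diff_left L2_scale u_L2 \<phi>_L2 L2_inner_scale_left)
    finally have "(LINT s|lebesgue_on {r..t}. LINT x|lebesgue_on \<Omega>. H x s) =
        exp (lam * t) * ?U t - exp (lam * r) * ?U r"
      using lebesgue_on_Fubini_compact[OF \<Omega> compact_Icc cont_H] by simp
    moreover have "(LINT x|lebesgue_on \<Omega>. H x s) = 0" if "s \<in> {r..t}" for s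
    proof -
      have s: "s > 0" using that r by simp
      have "(LINT x|lebesgue_on \<Omega>. H x s) =
          L2_inner \<Omega> (\<lambda>x. exp (lam * s) * (lam * u x s - ?L x s)) \<phi>"
        by (simp add: L2_inner_def H_def)
      also have "\<dots> = exp (lam * s) * (lam * ?U s - L2_inner \<Omega> (\<lambda>x. ?L x s) \<phi>)"
        using s by (simp add: L2_inner_diff_left L2_scale u_L2 \<phi>_L2 L_L2 L2_inner_scale_left)
      also have "\<dots> = 0"
        using L2_inner_diff_op_eigenfunction[OF \<phi> dom[OF s]] by simp
      finally show ?thesis .
    qed
    then have "(LINT s|lebesgue_on {r..t}. LINT x|lebesgue_on \<Omega>. H x s) = (LINT s|lebesgue_on {r..t}. 0)"
      by (intro Bochner_Integration.integral_cong) auto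
    ultimately show ?thesis by simp
  qed
  \<comment> \<open>The equation is available for positive times only, so the initial value enters
    as a limit of inner products as \<open>r\<close> decreases to 0.\<close>
  have ev: "\<forall>\<^sub>F r in at_right 0. r \<in> {0<..<t}"
    using t by (rule eventually_at_right_real)
  have "((\<lambda>r. ?U r) \<longlongrightarrow> L2_inner \<Omega> g \<phi>) (at_right 0)"
  proof (rule L2_inner_tendsto)
    show "((\<lambda>r. L2_norm \<Omega> (\<lambda>x. u x r - g x)) \<longlongrightarrow> 0) (at_right 0)"
      using u by (simp add: evolution_solution_def)
    show "\<forall>\<^sub>F r in at_right 0. (\<lambda>x. u x r) \<in> L2 \<Omega>"
      using ev by eventually_elim (auto intro: u_L2)
  qed (use g \<phi>_L2 in auto)
  moreover have "((\<lambda>r. exp (lam * r)) \<longlongrightarrow> exp (lam * 0)) (at_right 0)"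
    by (intro tendsto_intros)
  ultimately have "((\<lambda>r. exp (lam * r) * ?U r) \<longlongrightarrow> exp (lam * 0) * L2_inner \<Omega> g \<phi>) (at_right 0)"
    by (rule tendsto_mult[rotated])
  moreover have "\<forall>\<^sub>F r in at_right 0. exp (lam * r) * ?U r = exp (lam * t) * ?U t"
    using ev by eventually_elim (use const in auto)
  then have "((\<lambda>r. exp (lam * r) * ?U r) \<longlongrightarrow> exp (lam * t) * ?U t) (at_right 0)"
    by (rule tendsto_eventually)
  ultimately have "exp (lam * t) * ?U t = L2_inner \<Omega> g \<phi>"
    using tendsto_unique[OF trivial_limit_at_right_real] by fastforce
  then show ?thesis by (simp add: exp_minus field_simps)
qed

end

subsection \<open>Matrices of full column rank\<close>

lemma (in vec_space) full_column_rank_injective: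
  assumes A: "A \<in> carrier_mat n k" and rank: "rank A = k"
    and v: "v \<in> carrier_vec k" "A *\<^sub>v v = 0\<^sub>v n"
  shows "v = 0\<^sub>v k"
proof (rule ccontr)
  assume "v \<noteq> 0\<^sub>v k"
  \<comment> \<open>Linear independence is a property of the set of columns and would not notice a
    repeated column. The rank is the size of a maximal independent subset of that set, so rank
    \<open>k\<close> forces the \<open>k\<close> columns to be distinct.\<close>
  obtain S where S: "maximal S (\<lambda>T. T \<subseteq> set (cols A) \<and> lin_indpt T)"
    using maximal_exists[of "(\<lambda>T. T \<subseteq> set (cols A) \<and> lin_indpt T)" "card (set (cols A))" "{}"]
    by (meson List.finite_set card_mono empty_iff empty_subsetI finite_lin_indpt2 rev_finite_subset)
  then have "S \<subseteq> set (cols A)" by (simp add: maximal_def)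
  then have "rank A \<le> card (set (cols A))"
    using rank_card_indpt[OF A S] by (simp add: card_mono)
  then have "distinct (cols A)"
    using rank A card_length[of "cols A"] by (intro card_distinct) simp
  then show False
    using full_rank_lin_indpt[OF A rank] lin_depI[OF A v(1) \<open>v \<noteq> 0\<^sub>v k\<close> v(2)] by blast
qed

lemma mult_mat_vec_unit_vec:
  fixes A :: "'a::semiring_1 mat"
  assumes "A \<in> carrier_mat n k" "j < k"
  shows "A *\<^sub>v unit_vec k j = col A j"
  using assms by (intro eq_vecI) auto

text \<open>The Penrose condition \<open>A * X * A = A\<close> says that \<open>A\<close> maps
  column \<open>j\<close> of \<open>X * A\<close> and the unit vector \<open>j\<close> to the same
  vector, and full column rank makes \<open>A\<close> injective.\<close>

lemma moore_penrose_inverse_full_column_rank: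
  assumes A: "A \<in> carrier_mat n k" and rank: "vec_space.rank n A = k"
    and X: "moore_penrose_inverse A X"
  shows "X * A = 1\<^sub>m k"
proof -
  have X_dim: "X \<in> carrier_mat k n" and AXA: "A * X * A = A"
    using X A by (auto simp: moore_penrose_inverse_def)
  have XA: "X * A \<in> carrier_mat k k" using X_dim A by auto
  show ?thesis
  proof (rule eq_matI)
    fix i j assume "i < dim_row (1\<^sub>m k :: real mat)" "j < dim_col (1\<^sub>m k :: real mat)"
    then have ij: "i < k" "j < k" by auto
    let ?v = "col (X * A) j - unit_vec k j"
    have v: "?v \<in> carrier_vec k" by (intro carrier_vecI) simp
    have col: "col (X * A) j \<in> carrier_vec k" using XA by (intro carrier_vecI) auto
    have "A *\<^sub>v ?v = A *\<^sub>v col (X * A) j - A *\<^sub>v unit_vec k j"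
      by (intro mult_minus_distrib_mat_vec[OF A col]) simp
    also have "A *\<^sub>v col (X * A) j = col (A * (X * A)) j"
      by (rule col_mult2[OF A XA ij(2), symmetric])
    also have "A * (X * A) = A"
      using AXA assoc_mult_mat[OF A X_dim A] by simp
    also have "A *\<^sub>v unit_vec k j = col A j"
      using ij A by (simp add: mult_mat_vec_unit_vec[OF A])
    also have "col A j - col A j = 0\<^sub>v n"
      using A by auto
    finally have "?v = 0\<^sub>v k"
      by (rule vec_space.full_column_rank_injective[OF A rank v])
    then have "?v $ i = 0" using ij by simp
    moreover have "col (X * A) j $ i = (X * A) $$ (i, j)"
      using ij X_dim A by (intro index_col) auto
    ultimately show "(X * A) $$ (i, j) = 1\<^sub>m k $$ (i, j)"
      using ij by (auto split: if_splits)
  qed (use XA in auto)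
qed

text \<open>An entry is at most the norm of its column, which is the image of a unit vector. The
  supremum is an upper bound only after boundedness is shown, for which a crude estimate by all
  entries suffices.\<close>

lemma abs_entry_le_op_norm:
  fixes A :: "real mat"
  assumes A: "A \<in> carrier_mat n k" and ij: "i < n" "j < k"
  shows "\<bar>A $$ (i, j)\<bar> \<le> op_norm A"
proof -
  let ?B = "{v :: real vec. v \<in> carrier_vec (dim_col A) \<and> scalar_prod v v \<le> 1}"
  let ?f = "\<lambda>v. sqrt (scalar_prod (A *\<^sub>v v) (A *\<^sub>v v))"
  have entry_le: "(v $ l)\<^sup>2 \<le> scalar_prod v v" if "l < dim_vec v" for v :: "real vec" and l
    using that member_le_sum[of l "{0..<dim_vec v}" "\<lambda>l. (v $ l)\<^sup>2"]
    by (simp add: scalar_prod_def power2_eq_square)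
  have "?f v \<le> sqrt (\<Sum>r<n. (\<Sum>l<k. \<bar>A $$ (r, l)\<bar>)\<^sup>2)" if v: "v \<in> ?B" for v
  proof -
    have dim: "dim_vec v = k" and le1: "scalar_prod v v \<le> 1" using v A by auto
    have entry_le1: "\<bar>v $ l\<bar> \<le> 1" if "l < k" for l
    proof -
      have "(v $ l)\<^sup>2 \<le> 1" using entry_le[of l v] that dim le1 by linarith
      then show ?thesis by (simp add: abs_square_le_1)
    qed
    have row: "\<bar>(A *\<^sub>v v) $ r\<bar> \<le> (\<Sum>l<k. \<bar>A $$ (r, l)\<bar>)" if "r < n" for r
    proof -
      have "(A *\<^sub>v v) $ r = (\<Sum>l<k. A $$ (r, l) * v $ l)"
        using that A dim by (simp add: scalar_prod_def lessThan_atLeast0)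
      also have "\<bar>\<dots>\<bar> \<le> (\<Sum>l<k. \<bar>A $$ (r, l) * v $ l\<bar>)" by (rule sum_abs)
      also have "\<dots> \<le> (\<Sum>l<k. \<bar>A $$ (r, l)\<bar>)"
        using entry_le1 by (intro sum_mono) (simp add: abs_mult mult_left_le)
      finally show ?thesis .
    qed
    have "scalar_prod (A *\<^sub>v v) (A *\<^sub>v v) = (\<Sum>r<n. \<bar>(A *\<^sub>v v) $ r\<bar>\<^sup>2)"
      using A by (simp add: scalar_prod_def lessThan_atLeast0 power2_eq_square)
    also have "\<dots> \<le> (\<Sum>r<n. (\<Sum>l<k. \<bar>A $$ (r, l)\<bar>)\<^sup>2)"
      using row by (intro sum_mono power_mono) auto
    finally show ?thesis by simp
  qed
  then have bdd: "bdd_above (?f ` ?B)"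
    by (intro bdd_aboveI2)
  have "scalar_prod (unit_vec k j :: real vec) (unit_vec k j) = 1"
    using ij by (subst scalar_prod_right_unit) auto
  then have unit: "unit_vec k j \<in> ?B" using A ij by simp
  have "(A $$ (i, j))\<^sup>2 \<le> scalar_prod (col A j) (col A j)"
    using entry_le[of i "col A j"] A ij by simp
  then have "\<bar>A $$ (i, j)\<bar> \<le> sqrt (scalar_prod (col A j) (col A j))"
    by (simp add: real_le_rsqrt)
  also have "\<dots> = ?f (unit_vec k j)"
    using A ij by (simp add: mult_mat_vec_unit_vec[OF A])
  also have "\<dots> \<le> op_norm A"
    unfolding op_norm_def by (rule cSUP_upper[OF unit bdd])
  finally show ?thesis .
qed

subsection \<open>The moment problem for the controls\<close>

theorem theorem4p1:
  fixes \<Omega> :: "(real^'d::finite) set"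
    and N :: nat
    and p :: "('d \<Rightarrow> nat) \<Rightarrow> real^'d \<Rightarrow> real"
    and \<mu> :: "nat \<Rightarrow> real"
    and d :: "nat \<Rightarrow> nat"
    and D :: nat
    and \<phi> :: "nat \<Rightarrow> nat \<Rightarrow> real^'d \<Rightarrow> real"
    and M \<sigma> \<beta> \<theta> s C q \<alpha> :: real
    and b :: "nat \<Rightarrow> nat \<Rightarrow> nat \<Rightarrow> real"
    and B Bdag :: "nat \<Rightarrow> real mat"
    and g :: "nat \<Rightarrow> real^'d \<Rightarrow> real"
    and f :: "real^'d \<Rightarrow> real"
    and u :: "nat \<Rightarrow> real^'d \<Rightarrow> real \<Rightarrow> real"
    and w :: "real^'d \<Rightarrow> real \<Rightarrow> real"
  assumes domain: "smooth_compact_domain \<Omega>"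
    and operator: "elliptic_dirichlet_operator \<Omega> N p"
    and eigenvalues: "eigenvalues \<Omega> N p = \<mu> ` {1..}"
    and increasing: "\<And>n. n \<ge> 1 \<Longrightarrow> 0 < \<mu> n \<and> \<mu> n < \<mu> (Suc n)"
    and multiplicity: "\<And>n. n \<ge> 1 \<Longrightarrow> has_multiplicity \<Omega> N p (\<mu> n) (d n)"
    and max_multiplicity: "\<And>n. n \<ge> 1 \<Longrightarrow> d n \<le> D" "\<exists>n\<ge>1. d n = D"
    and eigenfunctions: "\<And>n l. n \<ge> 1 \<Longrightarrow> l < d n \<Longrightarrow> eigenfunction \<Omega> N p (\<mu> n) (\<phi> n l)"
    and basis: "L2_orthonormal_basis \<Omega> (SIGMA n:{1..}. {..<d n}) (\<lambda>(n, l). \<phi> n l)"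
    and A1: "M > 0" "0 < \<sigma>" "\<sigma> \<le> 1" "\<beta> > 1"
      "(\<lambda>n. \<mu> n / (M * real n powr \<beta>) - 1) \<in> o(\<lambda>n. real n powr (- \<sigma>))"
    and A2: "\<theta> > 0" "s \<ge> 0"
      "\<And>n. n \<ge> 1 \<Longrightarrow> \<mu> (Suc n) - \<mu> n \<ge> \<theta> * real n powr (- s)"
    and g_L2: "\<And>j. j < D \<Longrightarrow> g j \<in> L2 \<Omega>"
    and g_expansion: "\<And>j. j < D \<Longrightarrow>
      (\<lambda>K. L2_norm \<Omega> (\<lambda>x. g j x - (\<Sum>n=1..K. \<Sum>l<d n. b n j l * \<phi> n l x))) \<longlonglongrightarrow> 0"
    and B: "\<And>n. n \<ge> 1 \<Longrightarrow> B n = mat D (d n) (\<lambda>(j, l). b n j l)"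
    and B_rank: "\<And>n. n \<ge> 1 \<Longrightarrow> vec_space.rank D (B n) = d n"
    and Bdag: "\<And>n. n \<ge> 1 \<Longrightarrow> moore_penrose_inverse (B n) (Bdag n)"
    and constants: "C > 0" "q \<ge> 0" "0 \<le> \<alpha>" "\<alpha> < \<beta>"
    and Bdag_bound: "\<And>n. n \<ge> 1 \<Longrightarrow> op_norm (Bdag n) \<le> C * exp (q * real n powr \<alpha>)"
    and f_L2: "f \<in> L2 \<Omega>"
    and u_solution: "\<And>j. j < D \<Longrightarrow> evolution_solution \<Omega> N p (g j) (u j)"
    and w_solution: "evolution_solution \<Omega> N p f w"
  shows "\<forall>t0 t1 \<tau>. 0 \<le> t0 \<and> t0 < t1 \<and> t0 < \<tau> \<longrightarrow>
    (\<exists>\<nu> :: nat \<Rightarrow> real \<Rightarrow> real.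
      (\<forall>j<D. \<nu> j \<in> L2 {t0..t1}) \<and>
      (\<forall>x\<in>\<Omega>.
        (\<forall>j<D. integrable (lebesgue_on {t0..t1}) (\<lambda>t. u j x t * \<nu> j t)) \<and>
        w x \<tau> = (\<Sum>j<D. integral\<^sup>L (lebesgue_on {t0..t1}) (\<lambda>t. u j x t * \<nu> j t))))"
proof (intro allI impI)
  fix t0 t1 \<tau> :: real assume t: "0 \<le> t0 \<and> t0 < t1 \<and> t0 < \<tau>"
  \<comment> \<open>The controls vanish before \<open>x0\<close>, so the behaviour of \<open>u j x\<close> near time \<open>0\<close> is irrelevant.\<close>
  define x0 where "x0 = (t0 + min t1 \<tau>) / 2"
  \<comment> \<open>\<open>\<eta>\<close> is the time of decay remaining after \<open>x0\<close>.
    The half in \<open>\<epsilon>\<close> keeps the growth of the biorthogonal functions strictly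
    below this decay; the other term keeps the support inside the control interval.\<close>
  define \<eta> where "\<eta> = \<tau> - x0"
  define \<epsilon> where "\<epsilon> = min (t1 - x0) (\<eta> / 2)"
  have x0: "0 \<le> t0" "t0 < x0" "x0 < t1" "x0 < \<tau>"
    using t by (auto simp: x0_def min_def field_simps)
  have \<epsilon>: "\<epsilon> > 0" "\<epsilon> < \<eta>" "x0 + \<epsilon> \<le> t1"
    using x0 by (auto simp: \<epsilon>_def \<eta>_def min_less_iff_disj)
  have \<Omega>: "compact \<Omega>" "closure (interior \<Omega>) = \<Omega>"
    using domain by (auto simp: smooth_compact_domain_def)
  have sa: "self_adjoint_op \<Omega> N p"
    using operator by (simp add: elliptic_dirichlet_operator_def)
  note coefficient = evolution_coefficient[OF \<Omega>(1) sa]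
  have \<phi>_L2: "\<phi> n l \<in> L2 \<Omega>" if "n \<ge> 1" "l < d n" for n l
    by (rule eigenfunction_L2[OF \<Omega>(1) eigenfunctions[OF that]])
  have \<phi>_cont: "continuous_on \<Omega> (\<phi> n l)" if "n \<ge> 1" "l < d n" for n l
    using eigenfunctions[OF that] by (simp add: eigenfunction_def dirichlet_domain_def Ck_closed_def)
  have \<phi>_norm: "L2_norm \<Omega> (\<phi> n l) = 1" if "n \<ge> 1" "l < d n" for n l
    using basis that unfolding L2_orthonormal_basis_def L2_norm_def by force

  \<comment> \<open>Eigenvalues are numbered from 1, the exponentials above from 0; this is the
    origin of \<open>c j (n - 1)\<close> below.\<close>
  define lam where "lam = (\<lambda>k. \<mu> (Suc k))"
  obtain m0 m1 where m: "m0 > 0" "\<And>n. m0 * real (Suc n) powr \<beta> \<le> lam n"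
    "\<And>n. lam n \<le> m1 * real (Suc n) powr \<beta>"
    using powr_asymptotic_bounds[OF A1(1) A1(2) _ A1(5)] increasing unfolding lam_def by blast
  have gap: "lam (Suc n) - lam n \<ge> \<theta> * real (Suc n) powr (- s)" for n
    using A2(3)[of "Suc n"] by (simp add: lam_def)

  define F where "F = (\<lambda>n l. L2_inner \<Omega> f (\<phi> n l))"
  \<comment> \<open>Only \<open>\<eta>\<close> appears in the exponent, since the moment problem
    itself supplies the missing \<open>exp (- lam k * x0)\<close>; together they give decay up to
    time \<open>\<tau>\<close>.\<close>
  define c where "c = (\<lambda>j k. exp (- lam k * \<eta>) * (\<Sum>l<d (Suc k). Bdag (Suc k) $$ (l, j) * F (Suc k) l))"
  have B_carrier: "B n \<in> carrier_mat D (d n)" if "n \<ge> 1" for n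
    using B[OF that] by simp
  have Bdag_carrier: "Bdag n \<in> carrier_mat (d n) D" if "n \<ge> 1" for n
    using Bdag[OF that] B_carrier[OF that] by (auto simp: moore_penrose_inverse_def)
  have c_bound: "\<bar>c j k\<bar> \<le> real D * C * L2_norm \<Omega> f * exp (q * real (Suc k) powr \<alpha> - \<eta> * lam k)"
    if "j < D" for j k
  proof -
    let ?n = "Suc k" and ?E = "C * exp (q * real (Suc k) powr \<alpha>)"
    have nf: "L2_norm \<Omega> f \<ge> 0" by (simp add: L2_norm_def L2_inner_self_nonneg)
    have "\<bar>Bdag ?n $$ (l, j) * F ?n l\<bar> \<le> ?E * L2_norm \<Omega> f" if l: "l < d ?n" for l
    proof -
      have "\<bar>Bdag ?n $$ (l, j)\<bar> \<le> ?E"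
        using abs_entry_le_op_norm[OF Bdag_carrier l \<open>j < D\<close>] Bdag_bound[of ?n] by simp
      moreover have "\<bar>F ?n l\<bar> \<le> L2_norm \<Omega> f"
        using L2_Cauchy_Schwarz[OF f_L2 \<phi>_L2[of ?n l]] \<phi>_norm[of ?n l] l by (simp add: F_def)
      ultimately show ?thesis
        unfolding abs_mult using constants(1) by (intro mult_mono) auto
    qed
    then have "\<bar>\<Sum>l<d ?n. Bdag ?n $$ (l, j) * F ?n l\<bar> \<le> (\<Sum>l<d ?n. ?E * L2_norm \<Omega> f)"
      by (intro order_trans[OF sum_abs] sum_mono) auto
    also have "\<dots> = real (d ?n) * (?E * L2_norm \<Omega> f)" by simp
    also have "\<dots> \<le> real D * (?E * L2_norm \<Omega> f)"
      using max_multiplicity(1)[of ?n] constants(1) nf by (intro mult_right_mono) auto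
    finally have "\<bar>c j k\<bar> \<le> exp (- lam k * \<eta>) * (real D * (?E * L2_norm \<Omega> f))"
      unfolding c_def abs_mult by (simp add: mult_left_mono)
    also have "\<dots> = real D * C * L2_norm \<Omega> f * (exp (q * real (Suc k) powr \<alpha>) * exp (- lam k * \<eta>))"
      by (simp only: mult_ac)
    also have "exp (q * real (Suc k) powr \<alpha>) * exp (- lam k * \<eta>) = exp (q * real (Suc k) powr \<alpha> - \<eta> * lam k)"
      by (simp add: mult.commute flip: exp_add)
    finally show ?thesis .
  qed
  have "\<exists>\<nu>. j < D \<longrightarrow> continuous_on UNIV \<nu> \<and> (\<forall>t. t \<notin> {x0..x0 + \<epsilon>} \<longrightarrow> \<nu> t = 0) \<and>
      (\<forall>m. (LINT t|lborel. exp (- lam m * t) * \<nu> t) = exp (- lam m * x0) * c j m)" for j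
  proof (cases "j < D")
    case True
    show ?thesis
      by (rule exponential_moment_problem[OF m(1) A1(4) A2(1,2) m(2,3) gap \<epsilon>(1,2) constants(3,4) c_bound[OF True]])
        blast
  qed simp
  then obtain \<nu> where \<nu>: "\<And>j. j < D \<Longrightarrow> continuous_on UNIV (\<nu> j)"
    "\<And>j t. j < D \<Longrightarrow> t \<notin> {x0..x0 + \<epsilon>} \<Longrightarrow> \<nu> j t = 0"
    "\<And>j m. j < D \<Longrightarrow> (LINT t|lborel. exp (- lam m * t) * \<nu> j t) = exp (- lam m * x0) * c j m"
    by metis
  have \<nu>_cont: "continuous_on A (\<nu> j)" if "j < D" for j A
    using \<nu>(1)[OF that] continuous_on_subset by blast
  have u_cont: "continuous_on (\<Omega> \<times> {x0..t1}) (\<lambda>(x, t). u j x t)" if "j < D" for j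
  proof (rule continuous_on_subset)
    show "continuous_on (\<Omega> \<times> {0<..}) (\<lambda>(x, t). u j x t)"
      using u_solution[OF that] by (simp add: evolution_solution_def)
  qed (use x0 in auto)
  have moment: "(LINT t|lebesgue_on {x0..t1}. exp (- lam m * t) * \<nu> j t) = exp (- lam m * x0) * c j m"
    if "j < D" for j m
  proof -
    have "(LINT t|lebesgue_on {x0..t1}. exp (- lam m * t) * \<nu> j t) =
        (LINT t|lborel. indicator {x0..t1} t *\<^sub>R (exp (- lam m * t) * \<nu> j t))"
      using that by (intro integrable_lebesgue_on_compact(2) continuous_intros \<nu>_cont) auto
    also have "\<dots> = (LINT t|lborel. exp (- lam m * t) * \<nu> j t)"
    proof (intro Bochner_Integration.integral_cong refl)
      show "indicator {x0..t1} t *\<^sub>R (exp (- lam m * t) * \<nu> j t) = exp (- lam m * t) * \<nu> j t" for t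
        using \<nu>(2)[OF that, of t] \<epsilon>(3) by (cases "t \<in> {x0..t1}") auto
    qed
    finally show ?thesis using \<nu>(3)[OF that] by simp
  qed

  define I where "I = (\<lambda>j x. LINT t|lebesgue_on {x0..t1}. u j x t * \<nu> j t)"
  have uv_cont: "continuous_on (\<Omega> \<times> {x0..t1}) (\<lambda>(x, t). u j x t * \<nu> j t)" if "j < D" for j
  proof -
    have "continuous_on (\<Omega> \<times> {x0..t1}) (\<lambda>z. (case z of (x, t) \<Rightarrow> u j x t) * \<nu> j (snd z))"
      by (intro continuous_intros u_cont that continuous_on_compose2[OF \<nu>(1)[OF that]]) auto
    then show ?thesis by (simp add: case_prod_unfold)
  qed
  have I_cont: "continuous_on \<Omega> (I j)" if "j < D" for j
    unfolding I_def by (rule continuous_on_lebesgue_integral_param[OF uv_cont[OF that]])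
  have w_cont: "continuous_on \<Omega> (\<lambda>x. w x \<tau>)"
    using w_solution x0 by (auto simp: evolution_solution_def dirichlet_domain_def Ck_closed_def)
  \<comment> \<open>The error of the representation. Its orthogonality to the complete system gives
    zero almost everywhere, and its continuity then gives zero on all of
    \<open>\<Omega>\<close>.\<close>
  define W where "W = (\<lambda>x. w x \<tau> - (\<Sum>j<D. I j x))"
  have W_cont: "continuous_on \<Omega> W"
    unfolding W_def by (intro continuous_intros w_cont I_cont) auto
  have I_L2: "I j \<in> L2 \<Omega>" if "j < D" for j
    by (rule L2_continuous_on_compact[OF \<Omega>(1) I_cont[OF that]])

  have I_coefficient: "L2_inner \<Omega> (I j) (\<phi> n l) = b n j l * (exp (- \<mu> n * x0) * c j (n - 1))"
    if j: "j < D" and n: "n \<ge> 1" "l < d n" for j n l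
  proof -
    have "L2_inner \<Omega> (I j) (\<phi> n l) =
        (LINT t|lebesgue_on {x0..t1}. L2_inner \<Omega> (\<lambda>x. u j x t) (\<phi> n l) * \<nu> j t)"
      unfolding I_def by (rule L2_inner_time_average[OF \<Omega>(1) \<phi>_cont[OF n] u_cont[OF j] \<nu>_cont[OF j]])
    also have "\<dots> = (LINT t|lebesgue_on {x0..t1}. b n j l * (exp (- \<mu> n * t) * \<nu> j t))"
    proof (intro Bochner_Integration.integral_cong refl)
      fix t assume "t \<in> space (lebesgue_on {x0..t1})"
      then have "t > 0" using x0 by auto
      from coefficient[OF eigenfunctions[OF n] u_solution[OF j] g_L2[OF j] this]
      show "L2_inner \<Omega> (\<lambda>x. u j x t) (\<phi> n l) * \<nu> j t = b n j l * (exp (- \<mu> n * t) * \<nu> j t)"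
        using L2_orthonormal_expansion_coefficient[OF basis g_L2[OF j] g_expansion[OF j] n] by simp
    qed
    also have "\<dots> = b n j l * (LINT t|lebesgue_on {x0..t1}. exp (- \<mu> n * t) * \<nu> j t)"
      by (rule integral_mult_right_zero)
    also have "(LINT t|lebesgue_on {x0..t1}. exp (- \<mu> n * t) * \<nu> j t) = exp (- \<mu> n * x0) * c j (n - 1)"
      using moment[OF j, of "n - 1"] n by (simp add: lam_def)
    finally show ?thesis .
  qed

  have sum_coefficient: "(\<Sum>j<D. b n j l * (exp (- \<mu> n * x0) * c j (n - 1))) = exp (- \<mu> n * \<tau>) * F n l"
    if n: "n \<ge> 1" "l < d n" for n l
  proof -
    have BB: "Bdag n * B n = 1\<^sub>m (d n)"
      by (rule moore_penrose_inverse_full_column_rank[OF B_carrier B_rank Bdag]) (use n in auto)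
    \<comment> \<open>These are the entries of the left inverse identity; they decouple the
      \<open>d n\<close> eigenfunctions that share the eigenvalue \<open>\<mu> n\<close>.\<close>
    have entry: "(\<Sum>j<D. Bdag n $$ (l', j) * b n j l) = (if l' = l then 1 else 0)" if "l' < d n" for l'
    proof -
      have "(Bdag n * B n) $$ (l', l) = (\<Sum>j<D. Bdag n $$ (l', j) * b n j l)"
        using that n Bdag_carrier[OF n(1)] B[OF n(1)] by (simp add: scalar_prod_def lessThan_atLeast0)
      then show ?thesis using BB that n by simp
    qed
    have exps: "exp (- \<mu> n * x0) * exp (- \<mu> n * \<eta>) = exp (- \<mu> n * \<tau>)"
      by (simp add: \<eta>_def algebra_simps flip: exp_add)
    have "(\<Sum>j<D. b n j l * (exp (- \<mu> n * x0) * c j (n - 1))) =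
        (\<Sum>j<D. \<Sum>l'<d n. exp (- \<mu> n * \<tau>) * (F n l' * (Bdag n $$ (l', j) * b n j l)))"
      using n unfolding exps[symmetric] by (simp add: c_def lam_def sum_distrib_left mult_ac)
    also have "\<dots> = (\<Sum>l'<d n. \<Sum>j<D. exp (- \<mu> n * \<tau>) * (F n l' * (Bdag n $$ (l', j) * b n j l)))"
      by (rule sum.swap)
    also have "\<dots> = (\<Sum>l'<d n. if l' = l then exp (- \<mu> n * \<tau>) * F n l' else 0)"
      by (intro sum.cong refl) (simp add: entry flip: sum_distrib_left)
    also have "\<dots> = exp (- \<mu> n * \<tau>) * F n l"
      using n by simp
    finally show ?thesis .
  qed

  have "L2_inner \<Omega> W (\<phi> n l) = 0" if n: "n \<ge> 1" "l < d n" for n l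
  proof -
    have "L2_inner \<Omega> W (\<phi> n l) = L2_inner \<Omega> (\<lambda>x. w x \<tau>) (\<phi> n l) -
        L2_inner \<Omega> (\<lambda>x. \<Sum>j<D. I j x) (\<phi> n l)"
      unfolding W_def
      by (intro L2_inner_diff_left L2_sum I_L2 \<phi>_L2 n L2_continuous_on_compact \<Omega>(1) w_cont) simp
    also have "L2_inner \<Omega> (\<lambda>x. \<Sum>j<D. I j x) (\<phi> n l) = (\<Sum>j<D. L2_inner \<Omega> (I j) (\<phi> n l))"
      by (intro L2_inner_sum_left I_L2 \<phi>_L2 n) simp
    also have "L2_inner \<Omega> (\<lambda>x. w x \<tau>) (\<phi> n l) = exp (- \<mu> n * \<tau>) * F n l"
      using coefficient[OF eigenfunctions[OF n] w_solution f_L2, of \<tau>] x0 by (simp add: F_def)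
    also have "(\<Sum>j<D. L2_inner \<Omega> (I j) (\<phi> n l)) = exp (- \<mu> n * \<tau>) * F n l"
      using I_coefficient[OF _ n] sum_coefficient[OF n] by simp
    finally show ?thesis by simp
  qed
  then have "AE x in lebesgue_on \<Omega>. W x = 0"
    using basis L2_continuous_on_compact[OF \<Omega>(1) W_cont] unfolding L2_orthonormal_basis_def by auto
  then have W_zero: "W x = 0" if "x \<in> \<Omega>" for x
    by (rule continuous_on_AE_zero_closure_interior[OF \<Omega>(2) W_cont _ that])

  have sup: "u j x t * \<nu> j t = 0" if "j < D" "t \<in> {t0..t1} - {x0..t1}" for j x t
    using \<nu>(2)[OF that(1), of t] that(2) by auto
  have sub: "{x0..t1} \<in> sets lebesgue" "{t0..t1} \<in> sets lebesgue" "{x0..t1} \<subseteq> {t0..t1}"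
    using x0 by auto
  show "\<exists>\<nu> :: nat \<Rightarrow> real \<Rightarrow> real.
      (\<forall>j<D. \<nu> j \<in> L2 {t0..t1}) \<and>
      (\<forall>x\<in>\<Omega>.
        (\<forall>j<D. integrable (lebesgue_on {t0..t1}) (\<lambda>t. u j x t * \<nu> j t)) \<and>
        w x \<tau> = (\<Sum>j<D. integral\<^sup>L (lebesgue_on {t0..t1}) (\<lambda>t. u j x t * \<nu> j t)))"
  proof (intro exI[of _ \<nu>] conjI allI impI ballI)
    show "\<nu> j \<in> L2 {t0..t1}" if "j < D" for j
      by (rule L2_continuous_on_compact[OF compact_Icc \<nu>_cont[OF that]])
    fix x assume x: "x \<in> \<Omega>"
    show "integrable (lebesgue_on {t0..t1}) (\<lambda>t. u j x t * \<nu> j t)" if "j < D" for j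
      by (rule iffD2[OF lebesgue_on_support(1)[OF sub sup[where x = x, OF that]]
            integrable_lebesgue_on_compact(1)[OF compact_Icc continuous_on_slices(1)[OF uv_cont[OF that] x]]])
    have "integral\<^sup>L (lebesgue_on {t0..t1}) (\<lambda>t. u j x t * \<nu> j t) = I j x" if "j < D" for j
      unfolding I_def by (rule lebesgue_on_support(2)[OF sub sup[where x = x, OF that]])
    then show "w x \<tau> = (\<Sum>j<D. integral\<^sup>L (lebesgue_on {t0..t1}) (\<lambda>t. u j x t * \<nu> j t))"
      using W_zero[OF x] by (simp add: W_def)
  qed
qed

end
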